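(* Let $K=\mathbb{Q}(\sqrt6,\sqrt{19})$. A classical universal totally positive (definite) quadratic form over $\mathcal{O}_K$ must have at least $6$ variables.
   Context: $\mathcal{O}_K$ is the ring of integers of the totally real field $K$; $\mathcal{O}_K^+$ is the set of $\alpha\in\mathcal{O}_K$ that are totally positive, written $\alpha\succ 0$, i.e. $\sigma(\alpha)>0$ for every embedding $\sigma:K\to\mathbb{C}$. A quadratic form over $\mathcal{O}_K$ in $n$ variables is $Q(x_1,\dots,x_n)=\sum_{1\le i\le j\le n}a_{ij}x_ix_j$ with $a_{ij}\in\mathcal{O}_K$. It is totally positive definite if $Q(\gamma_1,\dots,\gamma_n)\succ0$ whenever $\gamma_1,\dots,\gamma_n\in\mathcal{O}_K$ are not all zero; classical if $a_{ij}$ is divisible by $2$ in $\mathcal{O}_K$ whenever $i\neq j$; universal if for every $\alpha\in\mathcal{O}_K^+$ there exist $\gamma_1,\dots,\gamma_n\in\mathcal{O}_K$ with $Q(\gamma_1,\dots,\gamma_n)=\alpha$. Throughout, only totally positive definite classical quadratic forms are considered. *)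

theory Defs
  imports Complex_Main "HOL-Computational_Algebra.Polynomial" "HOL-Algebra.Generated_Fields"
    "HOL-Algebra.Algebraic_Closure_Type"
begin

text \<open>
  Number fields are given as subfields \<open>K\<close> of the real numbers (as sets).
  A form in \<open>n\<close> variables is given by its coefficients \<open>a i j\<close>; only those with
  \<open>1 \<le> i \<le> j \<le> n\<close> matter. Likewise, of a vector \<open>x\<close> only \<open>x 1, \<dots>, x n\<close> matter.
\<close>

text \<open>The field generated by \<open>S\<close> contains the rationals, so this is \<open>\<rat>(S)\<close>.\<close>

definition adjoin_rats :: "real set \<Rightarrow> real set" where
  "adjoin_rats S = generate_field (ring_of_type_algebra :: real ring) S"

definition ring_of_integers :: "real set \<Rightarrow> real set" where
  "ring_of_integers K = {x \<in> K. algebraic_int x}"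

text \<open>
  Unital ring homomorphisms on the field \<open>K\<close>, hence injective; the values outside \<open>K\<close>
  are unconstrained.
\<close>

definition complex_embeddings :: "real set \<Rightarrow> (real \<Rightarrow> complex) set" where
  "complex_embeddings K =
     ring_hom (ring_of_type_algebra \<lparr>carrier := K\<rparr>) (ring_of_type_algebra :: complex ring)"

definition totally_positive :: "real set \<Rightarrow> real \<Rightarrow> bool" where
  "totally_positive K \<alpha> \<longleftrightarrow> (\<forall>\<sigma> \<in> complex_embeddings K. \<sigma> \<alpha> \<in> \<real> \<and> Re (\<sigma> \<alpha>) > 0)"

definition qform_eval :: "nat \<Rightarrow> (nat \<Rightarrow> nat \<Rightarrow> real) \<Rightarrow> (nat \<Rightarrow> real) \<Rightarrow> real" where
  "qform_eval n a x = (\<Sum>i = 1..n. \<Sum>j = i..n. a i j * x i * x j)"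

definition quadratic_form_over :: "real set \<Rightarrow> nat \<Rightarrow> (nat \<Rightarrow> nat \<Rightarrow> real) \<Rightarrow> bool" where
  "quadratic_form_over K n a \<longleftrightarrow>
     (\<forall>i j. 1 \<le> i \<and> i \<le> j \<and> j \<le> n \<longrightarrow> a i j \<in> ring_of_integers K)"

definition totally_positive_definite :: "real set \<Rightarrow> nat \<Rightarrow> (nat \<Rightarrow> nat \<Rightarrow> real) \<Rightarrow> bool" where
  "totally_positive_definite K n a \<longleftrightarrow>
     (\<forall>\<gamma>. (\<forall>i \<in> {1..n}. \<gamma> i \<in> ring_of_integers K) \<and> (\<exists>i \<in> {1..n}. \<gamma> i \<noteq> 0)
        \<longrightarrow> totally_positive K (qform_eval n a \<gamma>))"

definition classical_form :: "real set \<Rightarrow> nat \<Rightarrow> (nat \<Rightarrow> nat \<Rightarrow> real) \<Rightarrow> bool" where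
  "classical_form K n a \<longleftrightarrow>
     (\<forall>i j. 1 \<le> i \<and> i < j \<and> j \<le> n \<longrightarrow> (\<exists>b \<in> ring_of_integers K. a i j = 2 * b))"

definition universal_form :: "real set \<Rightarrow> nat \<Rightarrow> (nat \<Rightarrow> nat \<Rightarrow> real) \<Rightarrow> bool" where
  "universal_form K n a \<longleftrightarrow>
     (\<forall>\<alpha> \<in> ring_of_integers K. totally_positive K \<alpha> \<longrightarrow>
        (\<exists>\<gamma>. (\<forall>i \<in> {1..n}. \<gamma> i \<in> ring_of_integers K) \<and> qform_eval n a \<gamma> = \<alpha>))"

end

theory Submission
  imports Defs "HOL-Computational_Algebra.Squarefree"
begin

text \<open>
  Six totally positive integers \<open>\<alpha>\<^sub>1, \<dots>, \<alpha>\<^sub>6\<close> are exhibited such that for \<open>i \<noteq> j\<close> the only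
  integer \<open>\<gamma>\<close> with \<open>\<gamma>\<^sup>2 \<le> \<alpha>\<^sub>i \<alpha>\<^sub>j\<close> in all real embeddings is \<open>0\<close>. If vectors \<open>v\<^sub>i\<close> represent
  the \<open>\<alpha>\<^sub>i\<close>, then, the form being classical, the value \<open>\<gamma> = B(v\<^sub>i, v\<^sub>j)\<close> of its bilinear form
  is an integer, and it satisfies this inequality by Cauchy--Schwarz. So the \<open>v\<^sub>i\<close> are pairwise
  orthogonal, hence linearly independent, and at least six variables are needed.

  For each pair the condition on \<open>\<gamma>\<close> is a finite check: after multiplying \<open>\<gamma>\<close> by a suitable unit
  the trace of \<open>\<gamma>\<^sup>2\<close> is small. It takes place in the ring of integers, which has the integral basis
  \<open>1, \<surd>6, \<surd>19, (\<surd>6 + \<surd>114)/2\<close>. That every integer of the field is in this lattice is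
  seen through almost integrality (the powers of the element have a common denominator), which is
  visibly stable under sums, products and conjugation.
\<close>

section \<open>The field\<close>

lemma ring_of_type_algebra_simps [simp]:
  "carrier (ring_of_type_algebra :: 'a::ring_1 ring) = UNIV"
  "\<one>\<^bsub>(ring_of_type_algebra :: 'a ring)\<^esub> = 1"
  "\<zero>\<^bsub>(ring_of_type_algebra :: 'a ring)\<^esub> = 0"
  "x \<otimes>\<^bsub>(ring_of_type_algebra :: 'a ring)\<^esub> y = x * y"
  "x \<oplus>\<^bsub>(ring_of_type_algebra :: 'a ring)\<^esub> y = x + y"
  by (simp_all add: ring_of_type_algebra_def)

lemma ring_of_type_algebra_minus [simp]:
  fixes x :: "'a::field"
  shows "\<ominus>\<^bsub>ring_of_type_algebra\<^esub> x = - x"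
proof -
  interpret R: Ring.field "ring_of_type_algebra :: 'a ring"
    by (rule field_from_type_algebra)
  have "x \<oplus>\<^bsub>ring_of_type_algebra\<^esub> (- x) = \<zero>\<^bsub>ring_of_type_algebra\<^esub>"
    by (subst ring_of_type_algebra_simps)+ simp
  then show ?thesis
    using R.minus_equality[of "- x" x] by (simp add: add.commute)
qed

lemma ring_of_type_algebra_inv [simp]:
  fixes x :: "'a::field"
  assumes "x \<noteq> 0"
  shows "inv\<^bsub>ring_of_type_algebra\<^esub> x = inverse x"
proof -
  interpret R: Ring.field "ring_of_type_algebra :: 'a ring"
    by (rule field_from_type_algebra)
  show ?thesis
    by (rule R.comm_inv_char) (use assms in auto)
qed

section \<open>Irrationality of the square roots of 6, 19 and 114\<close>

text \<open>For \<open>x = a / b\<close> in lowest terms, \<open>b ^ 2\<close> divides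
  \<open>D * a ^ 2\<close>, hence \<open>D\<close>, and squarefreeness forces \<open>b = 1\<close>.
  With \<open>D = 1\<close> this serves irrationality; with \<open>D\<close> equal to 6, 19 and 114
  it later bounds the denominators of coordinates.\<close>

lemma Rats_int_multiple_square:
  fixes x :: "'a::field_char_0"
  assumes "squarefree (D::int)" "x \<in> \<rat>" "of_int D * x ^ 2 \<in> \<int>"
  shows "x \<in> \<int>"
proof -
  obtain a b where ab: "b > 0" "coprime a b" "x = of_int a / of_int b"
    using Rats_cases'[OF \<open>x \<in> \<rat>\<close>] by metis
  obtain k where k: "of_int D * x ^ 2 = of_int k"
    using assms(3) by (auto elim: Ints_cases)
  have "(of_int (D * a ^ 2) :: 'a) = of_int (k * b ^ 2)"
    using k ab by (simp add: field_simps)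
  then have "D * a ^ 2 = k * b ^ 2"
    by (simp only: of_int_eq_iff)
  then have "b ^ 2 dvd D * a ^ 2" by simp
  moreover have "coprime (b ^ 2) (a ^ 2)"
    using ab(2) by (simp add: coprime_commute)
  ultimately have "b ^ 2 dvd D"
    by (simp add: coprime_dvd_mult_left_iff)
  then have "b dvd 1"
    using assms(1) by (auto dest: squarefreeD)
  then have "b = 1" using ab(1) by auto
  then show ?thesis using ab by simp
qed

lemma squarefree_numerals:
  "squarefree (6::int)" "squarefree (19::int)" "squarefree (114::int)"
proof -
  have "prime (2::int)" "prime (3::int)" by simp_all
  moreover have "prime (19::int)" 
    by (simp add: prime_int_numeral_eq) 
  ultimately have "squarefree (2::int)" "squarefree (3::int)" and s19: "squarefree (19::int)"
    by (auto intro: squarefree_prime)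
  then have s6: "squarefree (2 * 3::int)"
    by (intro squarefree_mult_coprime) auto
  have "coprime (2 * 3) (19::int)"
    by code_simp
  then have "squarefree (2 * 3 * 19::int)"
    by (intro squarefree_mult_coprime s6 s19)
  with s6 s19 show "squarefree (6::int)" "squarefree (19::int)" "squarefree (114::int)"
    by simp_all
qed

lemma int_square_not_between:
  fixes n k m :: int
  assumes "0 \<le> k" "k ^ 2 < m" "m < (k + 1) ^ 2"
  shows "n ^ 2 \<noteq> m"
proof
  assume "n ^ 2 = m"
  then have "k < \<bar>n\<bar>" "\<bar>n\<bar> < k + 1"
    using assms abs_le_square_iff[of n k] abs_le_square_iff[of "k + 1" n] by (auto simp: not_le[symmetric])
  then show False by simp
qed

lemma Rats_square_ne:
  fixes x :: real
  assumes "x \<in> \<rat>"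
  shows "x ^ 2 \<noteq> 6" "x ^ 2 \<noteq> 19" "x ^ 2 \<noteq> 114"
proof -
  have int: "x \<in> \<int>" if "x ^ 2 = of_int m" for m
    using Rats_int_multiple_square[of 1 x] assms that by simp
  have "x ^ 2 \<noteq> of_int m" if "0 \<le> k" "k ^ 2 < m" "m < (k + 1) ^ 2" for k m :: int
  proof
    assume *: "x ^ 2 = of_int m"
    then obtain n where "x = of_int n"
      using int by (auto elim: Ints_cases)
    with * have "n ^ 2 = m" by (simp only: of_int_eq_iff flip: of_int_power)
    with int_square_not_between[OF that] show False by blast
  qed
  \<comment> \<open>The enclosing squares are 4 < 6 < 9, 16 < 19 < 25 and 100 < 114 < 121.\<close>
  from this[of 2 6] this[of 4 19] this[of 10 114] show "x ^ 2 \<noteq> 6" "x ^ 2 \<noteq> 19" "x ^ 2 \<noteq> 114"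
    by simp_all
qed

section \<open>Arithmetic in rational coordinates\<close>

text \<open>The two roots are parameters, so that a conjugation changes \<open>x\<close> and
  \<open>y\<close> and keeps the coordinates.\<close>

definition biquad :: "real \<Rightarrow> real \<Rightarrow> real \<Rightarrow> real \<Rightarrow> real \<Rightarrow> real \<Rightarrow> real" where
  "biquad x y p q r s = p + q * x + r * y + s * (x * y)"

text \<open>The four sign choices, one for each embedding of the field.\<close>

definition sqrts :: "(real \<times> real) set" where
  "sqrts = {(x, y). x * x = 6 \<and> y * y = 19}"

lemma sqrts_iff: "(x, y) \<in> sqrts \<longleftrightarrow> (x = sqrt 6 \<or> x = - sqrt 6) \<and> (y = sqrt 19 \<or> y = - sqrt 19)"
proof -
  have "x * x = c \<longleftrightarrow> x = sqrt c \<or> x = - sqrt c" if "0 \<le> c" for x c :: real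
    using that by (metis power2_eq_iff power2_eq_square real_sqrt_mult_self abs_of_nonneg)
  from this[of 6 x] this[of 19 y] show ?thesis by (simp add: sqrts_def)
qed

lemma sqrts_neg: 
  assumes "(x, y) \<in> sqrts"
  shows "(- x, y) \<in> sqrts" "(x, - y) \<in> sqrts" "(- x, - y) \<in> sqrts"
  using assms by (auto simp: sqrts_def)

lemma biquad_add:
  "biquad x y p q r s + biquad x y p' q' r' s' = biquad x y (p + p') (q + q') (r + r') (s + s')"
  by (simp add: biquad_def algebra_simps)

lemma biquad_mult:
  assumes "(x, y) \<in> sqrts"
  shows "biquad x y p q r s * biquad x y p' q' r' s' =
    biquad x y (p * p' + 6 * q * q' + 19 * r * r' + 114 * s * s')
      (p * q' + q * p' + 19 * (r * s' + s * r'))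
      (p * r' + r * p' + 6 * (q * s' + s * q'))
      (p * s' + s * p' + q * r' + r * q')"
proof -
  have sq: "x * x = 6" "y * y = 19" using assms by (auto simp: sqrts_def)
  have sq': "x * (x * z) = 6 * z" "y * (y * z) = 19 * z" for z
    by (simp_all add: sq flip: mult.assoc)
  show ?thesis
    unfolding biquad_def by (simp add: sq sq' algebra_simps)
qed

text \<open>The field has degree 4. If \<open>r + s * x\<close> were nonzero, then
  \<open>y = u + v * x\<close> with rational \<open>u\<close>, \<open>v\<close>; squaring and
  comparing coefficients gives \<open>u * v = 0\<close>, so 19 or 114 would be the square of a
  rational.\<close>

lemma biquad_eq_0:
  assumes xy: "(x, y) \<in> sqrts"
    and rat: "p \<in> \<rat>" "q \<in> \<rat>" "r \<in> \<rat>" "s \<in> \<rat>"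
    and 0: "biquad x y p q r s = 0"
  shows "p = 0 \<and> q = 0 \<and> r = 0 \<and> s = 0"
proof -
  have x: "x * x = 6" and y: "y * y = 19" using xy by (auto simp: sqrts_def)
  have indep: "a = 0 \<and> b = 0" if "a \<in> \<rat>" "b \<in> \<rat>" "a + b * x = 0" for a b
  proof (cases "b = 0")
    case False
    then have "x = - a / b" using that(3) by (simp add: field_simps eq_neg_iff_add_eq_0)
    then have "x \<in> \<rat>" using that by simp
    then show ?thesis using Rats_square_ne(1)[of x] x by (simp add: power2_eq_square)
  qed (use that in auto)
  show ?thesis
  proof (cases "r + s * x = 0")
    case True
    then have "r = 0" "s = 0" using indep rat by blast+
    moreover from this have "p + q * x = 0" using 0 by (simp add: biquad_def)
    then have "p = 0" "q = 0" using indep rat by blast+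
    ultimately show ?thesis by simp
  next
    case False
    \<comment> \<open>The norm of \<open>r + s * x\<close>. Multiplying by \<open>r - s * x\<close>
      and dividing by \<open>t\<close> solves the relation for \<open>y\<close>.\<close>
    define t where "t = r * r - 6 * s * s"
    have "t \<noteq> 0"
    proof
      assume "t = 0"
      moreover have "(r + s * x) * (r + (- s) * x) = r * r - s * s * (x * x)"
        by (simp add: algebra_simps)
      ultimately have "(r + s * x) * (r + (- s) * x) = 0" using x unfolding t_def by simp
      then have "r + (- s) * x = 0" using False by simp
      then have "r = 0 \<and> - s = 0" using indep[of r "- s"] rat by simp
      then show False using False by simp
    qed
    have trat: "t \<in> \<rat>" unfolding t_def using rat by simp
    define u where "u = (6 * q * s - p * r) / t"
    define v where "v = (p * s - q * r) / t"
    have uv: "u \<in> \<rat>" "v \<in> \<rat>" unfolding u_def v_def using rat trat by simp_all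
    have "t * y = (6 * q * s - p * r) + (p * s - q * r) * x"
    proof -
      have "x * (x * z) = 6 * z" for z using x by (simp flip: mult.assoc)
      then have "(p + q * x + r * y + s * (x * y)) * (r - s * x)
          = t * y - ((6 * q * s - p * r) + (p * s - q * r) * x)"
        using x unfolding t_def by (simp add: algebra_simps)
      then show ?thesis using 0 by (simp add: biquad_def)
    qed
    then have y': "y = u + v * x"
      unfolding u_def v_def using \<open>t \<noteq> 0\<close> by (simp add: field_simps)
    have "y * y = u * u + v * v * (x * x) + (2 * u * v) * x"
      unfolding y' by (simp add: algebra_simps)
    then have "(u * u + 6 * (v * v) - 19) + (2 * u * v) * x = 0"
      using x y by simp
    then have "u * u + 6 * (v * v) - 19 = 0 \<and> 2 * u * v = 0"
      using uv by (intro indep) simp_all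
    then have "u ^ 2 = 19 \<or> (6 * v) ^ 2 = 114"
      by (auto simp: power2_eq_square)
    then show ?thesis using Rats_square_ne[of u] Rats_square_ne[of "6 * v"] uv by auto
  qed
qed

lemma biquad_inj:
  assumes "(x, y) \<in> sqrts" "biquad x y p q r s = biquad x y p' q' r' s'"
    "p \<in> \<rat>" "q \<in> \<rat>" "r \<in> \<rat>" "s \<in> \<rat>" "p' \<in> \<rat>" "q' \<in> \<rat>" "r' \<in> \<rat>" "s' \<in> \<rat>"
  shows "p = p' \<and> q = q' \<and> r = r' \<and> s = s'"
proof -
  have "biquad x y (p - p') (q - q') (r - r') (s - s') = 0"
    using assms(2) by (simp add: biquad_def algebra_simps)
  from biquad_eq_0[OF assms(1) _ _ _ _ this] assms show ?thesis by simp
qed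

abbreviation K0 :: "real set" where "K0 \<equiv> adjoin_rats {sqrt 6, sqrt 19}"

lemma std_sqrts: "(sqrt 6, sqrt 19) \<in> sqrts"
  by (simp add: sqrts_def)

lemma generate_field_Rats:
  fixes x :: real
  assumes "x \<in> \<rat>"
  shows "x \<in> adjoin_rats S"
proof -
  let ?F = "adjoin_rats S"
  note F = generate_field.intros[where R = "ring_of_type_algebra :: real ring" and H = S,
      folded adjoin_rats_def, simplified]
  have zero: "0 \<in> ?F" using F(5)[OF F(1) F(3)[OF F(1)]] by simp
  have nat: "of_nat n \<in> ?F" for n by (induction n) (auto simp: zero intro: F)
  have int: "of_int n \<in> ?F" for n
    by (cases n rule: int_cases2) (use nat F(3) in fastforce)+
  obtain a b where "b > 0" "x = of_int a / of_int b"
    using Rats_cases'[OF assms] by metis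
  then show ?thesis
    using F(6)[OF int F(4)[OF int], of b a] by (simp add: divide_inverse)
qed

text \<open>Only closure under inverses takes work: the inverse of \<open>h\<close> is the product
  of its three other conjugates divided by its norm.\<close>

lemma K0_eq: "K0 = {biquad (sqrt 6) (sqrt 19) p q r s |p q r s. p \<in> \<rat> \<and> q \<in> \<rat> \<and> r \<in> \<rat> \<and> s \<in> \<rat>}"
  (is "_ = ?B")
proof
  note std = std_sqrts
  have BI: "z \<in> ?B" if "z = biquad (sqrt 6) (sqrt 19) p q r s" "p \<in> \<rat>" "q \<in> \<rat>" "r \<in> \<rat>" "s \<in> \<rat>" for z p q r s
    using that by blast
  have mult: "a * b \<in> ?B" if "a \<in> ?B" "b \<in> ?B" for a b
  proof -
    from that obtain p q r s p' q' r' s' where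
      "a = biquad (sqrt 6) (sqrt 19) p q r s" "b = biquad (sqrt 6) (sqrt 19) p' q' r' s'"
      and rat: "p \<in> \<rat>" "q \<in> \<rat>" "r \<in> \<rat>" "s \<in> \<rat>" "p' \<in> \<rat>" "q' \<in> \<rat>" "r' \<in> \<rat>" "s' \<in> \<rat>"
      by blast
    then have "a * b = biquad (sqrt 6) (sqrt 19) (p * p' + 6 * q * q' + 19 * r * r' + 114 * s * s')
      (p * q' + q * p' + 19 * (r * s' + s * r')) (p * r' + r * p' + 6 * (q * s' + s * q'))
      (p * s' + s * p' + q * r' + r * q')"
      using biquad_mult[OF std] by simp
    from this show ?thesis by (rule BI) (use rat in simp_all)
  qed
  show "K0 \<subseteq> ?B"
  proof
    fix z assume "z \<in> K0"
    then show "z \<in> ?B"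
      unfolding adjoin_rats_def
    proof (induction rule: generate_field.induct)
      case one
      then show ?case by (intro BI[of _ 1 0 0 0]) (simp_all add: biquad_def)
    next
      case (incl h)
      then consider "h = sqrt 6" | "h = sqrt 19" by auto
      then show ?case
        by cases (intro BI[of _ 0 1 0 0] BI[of _ 0 0 1 0]; simp add: biquad_def)+
    next
      case (a_inv h)
      have "- 1 \<in> ?B" by (intro BI[of _ "- 1" 0 0 0]) (simp_all add: biquad_def)
      from mult[OF this a_inv.IH] show ?case by simp
    next
      case (m_inv h)
      then have "h \<noteq> 0" by simp
      obtain p q r s where h: "h = biquad (sqrt 6) (sqrt 19) p q r s"
        and rat: "p \<in> \<rat>" "q \<in> \<rat>" "r \<in> \<rat>" "s \<in> \<rat>"
        using m_inv.IH by blast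
      let ?c = "\<lambda>x y. biquad x y p q r s"
      have c: "?c (sqrt 6) (- sqrt 19) = biquad (sqrt 6) (sqrt 19) p q (- r) (- s)"
        "?c (- sqrt 6) (sqrt 19) = biquad (sqrt 6) (sqrt 19) p (- q) r (- s)"
        "?c (- sqrt 6) (- sqrt 19) = biquad (sqrt 6) (sqrt 19) p (- q) (- r) s"
        by (simp_all add: biquad_def)
      define g where "g = ?c (sqrt 6) (- sqrt 19) * ?c (- sqrt 6) (sqrt 19) * ?c (- sqrt 6) (- sqrt 19)"
      have nz: "?c x y \<noteq> 0" if "(x, y) \<in> sqrts" for x y
      proof
        assume "?c x y = 0"
        from biquad_eq_0[OF that rat this] have "h = 0" by (simp add: h biquad_def)
        then show False using \<open>h \<noteq> 0\<close> by simp
      qed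
      have "g \<noteq> 0"
        unfolding g_def using nz[OF sqrts_neg(1)[OF std]] nz[OF sqrts_neg(2)[OF std]] nz[OF sqrts_neg(3)[OF std]]
        by simp
      have gB: "g \<in> ?B" unfolding g_def c using rat by (intro mult BI[OF refl]) simp_all
      \<comment> \<open>\<open>A + B * sqrt 6\<close> is the relative norm of \<open>h\<close> to
        the subfield generated by \<open>sqrt 6\<close>, and \<open>N\<close> is the absolute
        norm.\<close>
      define A where "A = p * p + 6 * q * q - 19 * r * r - 114 * s * s"
      define B where "B = 2 * p * q - 38 * r * s"
      define N where "N = A * A - 6 * B * B"
      have "h * g = N"
      proof -
        have sq: "sqrt 6 * sqrt 6 = 6" "sqrt 19 * sqrt 19 = (19::real)" by simp_all
        have "sqrt 6 * (sqrt 6 * z) = 6 * z" "sqrt 19 * (sqrt 19 * z) = 19 * z" for z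
          by (simp_all flip: mult.assoc)
        then have "h * ?c (sqrt 6) (- sqrt 19) = A + B * sqrt 6"
          "?c (- sqrt 6) (sqrt 19) * ?c (- sqrt 6) (- sqrt 19) = A - B * sqrt 6"
          using sq unfolding A_def B_def h biquad_def by (simp_all add: algebra_simps del: real_sqrt_mult_self)
        then have "h * g = (A + B * sqrt 6) * (A - B * sqrt 6)"
          unfolding g_def by (metis mult.assoc)
        also have "\<dots> = A * A - (sqrt 6 * sqrt 6) * B * B" by (simp only: algebra_simps)
        also have "\<dots> = N" unfolding N_def by simp
        finally show ?thesis .
      qed
      moreover have "N \<in> \<rat>" unfolding N_def A_def B_def using rat by simp
      moreover have "h * g \<noteq> 0" using \<open>h \<noteq> 0\<close> \<open>g \<noteq> 0\<close> by simp
      ultimately have "inverse h = g * inverse N" using \<open>g \<noteq> 0\<close> \<open>h \<noteq> 0\<close> by (auto simp: field_simps)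
      moreover have "inverse N \<in> ?B"
        by (rule BI[of _ "inverse N" 0 0 0]) (use \<open>N \<in> \<rat>\<close> in \<open>simp_all add: biquad_def\<close>)
      ultimately show ?case using mult[OF gB] \<open>h \<noteq> 0\<close> by simp
    next
      case (eng_add h1 h2)
      then obtain p q r s p' q' r' s' where
        "h1 = biquad (sqrt 6) (sqrt 19) p q r s" "h2 = biquad (sqrt 6) (sqrt 19) p' q' r' s'"
        and rat: "p \<in> \<rat>" "q \<in> \<rat>" "r \<in> \<rat>" "s \<in> \<rat>" "p' \<in> \<rat>" "q' \<in> \<rat>" "r' \<in> \<rat>" "s' \<in> \<rat>"
        by blast
      then have "h1 + h2 = biquad (sqrt 6) (sqrt 19) (p + p') (q + q') (r + r') (s + s')"
        by (simp add: biquad_add)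
      then have "h1 + h2 \<in> ?B" by (rule BI) (use rat in simp_all)
      then show ?case by simp
    next
      case (eng_mult h1 h2)
      then show ?case using mult by simp
    qed
  qed
  show "?B \<subseteq> K0"
  proof
    fix z assume "z \<in> ?B"
    then obtain p q r s where *: "z = biquad (sqrt 6) (sqrt 19) p q r s"
      "p \<in> \<rat>" "q \<in> \<rat>" "r \<in> \<rat>" "s \<in> \<rat>" by blast
    note F = generate_field.intros[where R = "ring_of_type_algebra :: real ring" and H = "{sqrt 6, sqrt 19}",
      folded adjoin_rats_def, simplified]
    have "sqrt 6 \<in> K0" "sqrt 19 \<in> K0" by (auto intro: F(2))
    then show "z \<in> K0"
      unfolding *(1) biquad_def
      by (intro F(5,6) *(2-5)[THEN generate_field_Rats])
  qed
qed

section \<open>Embeddings and almost integral elements\<close>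

lemma K0_cases:
  assumes "z \<in> K0"
  obtains p q r s where "z = biquad (sqrt 6) (sqrt 19) p q r s"
    "p \<in> \<rat>" "q \<in> \<rat>" "r \<in> \<rat>" "s \<in> \<rat>"
  using assms unfolding K0_eq by blast

lemma K0_I:
  "p \<in> \<rat> \<Longrightarrow> q \<in> \<rat> \<Longrightarrow> r \<in> \<rat> \<Longrightarrow> s \<in> \<rat> \<Longrightarrow> biquad (sqrt 6) (sqrt 19) p q r s \<in> K0"
  unfolding K0_eq by blast

lemma K0_closed:
  "1 \<in> K0" "a \<in> K0 \<Longrightarrow> b \<in> K0 \<Longrightarrow> a + b \<in> K0" "a \<in> K0 \<Longrightarrow> b \<in> K0 \<Longrightarrow> a * b \<in> K0"
  "a \<in> K0 \<Longrightarrow> a ^ k \<in> K0"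
proof -
  note F = generate_field.intros[where R = "ring_of_type_algebra :: real ring" and H = "{sqrt 6, sqrt 19}",
      folded adjoin_rats_def, simplified]
  show *: "1 \<in> K0" "a \<in> K0 \<Longrightarrow> b \<in> K0 \<Longrightarrow> a + b \<in> K0" "a \<in> K0 \<Longrightarrow> b \<in> K0 \<Longrightarrow> a * b \<in> K0" for a b
    by (fact F(1), rule F(5), assumption+, rule F(6))
  show "a \<in> K0 \<Longrightarrow> a ^ k \<in> K0"
    by (induction k) (auto intro: *)
qed

text \<open>The conjugation with \<open>\<surd>6 \<mapsto> x\<close> and \<open>\<surd>19 \<mapsto> y\<close>, specified only on the field.\<close>

definition conj_at :: "real \<Rightarrow> real \<Rightarrow> real \<Rightarrow> real" where
  "conj_at x y z = (THE w. \<exists>p\<in>\<rat>. \<exists>q\<in>\<rat>. \<exists>r\<in>\<rat>. \<exists>s\<in>\<rat>.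
     z = biquad (sqrt 6) (sqrt 19) p q r s \<and> w = biquad x y p q r s)"

lemma conj_at_biquad:
  assumes "p \<in> \<rat>" "q \<in> \<rat>" "r \<in> \<rat>" "s \<in> \<rat>"
  shows "conj_at x y (biquad (sqrt 6) (sqrt 19) p q r s) = biquad x y p q r s"
  unfolding conj_at_def
proof (rule the_equality)
  fix w
  assume "\<exists>p'\<in>\<rat>. \<exists>q'\<in>\<rat>. \<exists>r'\<in>\<rat>. \<exists>s'\<in>\<rat>.
    biquad (sqrt 6) (sqrt 19) p q r s = biquad (sqrt 6) (sqrt 19) p' q' r' s' \<and> w = biquad x y p' q' r' s'"
  then show "w = biquad x y p q r s"
    using biquad_inj[OF std_sqrts] assms by (elim bexE conjE) metis
qed (use assms in blast)

lemma conj_at_Rats: "t \<in> \<rat> \<Longrightarrow> conj_at x y t = t"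
  using conj_at_biquad[of t 0 0 0 x y] by (simp add: biquad_def)

lemma conj_at_add:
  assumes "a \<in> K0" "b \<in> K0"
  shows "conj_at x y (a + b) = conj_at x y a + conj_at x y b"
  using assms by (elim K0_cases) (simp add: biquad_add conj_at_biquad)

lemma conj_at_mult:
  assumes "(x, y) \<in> sqrts" "a \<in> K0" "b \<in> K0"
  shows "conj_at x y (a * b) = conj_at x y a * conj_at x y b"
  using assms(2,3)
  by (elim K0_cases) (simp add: biquad_mult[OF std_sqrts] biquad_mult[OF assms(1)] conj_at_biquad)

lemma conj_at_power:
  assumes "(x, y) \<in> sqrts" "a \<in> K0"
  shows "conj_at x y (a ^ k) = conj_at x y a ^ k"
  by (induction k) (simp_all add: conj_at_Rats conj_at_mult K0_closed assms)

lemma conj_at_embedding: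
  assumes "(x, y) \<in> sqrts"
  shows "(\<lambda>z. complex_of_real (conj_at x y z)) \<in> complex_embeddings K0"
  unfolding complex_embeddings_def
  by (rule ring_hom_memI) (simp_all add: conj_at_add conj_at_mult assms conj_at_Rats)

text \<open>An embedding fixes the rationals and sends each root to a complex number with the same
  positive square, which is therefore real. So the field is totally real and has no embeddings
  besides the four conjugations.\<close>

lemma complex_embedding_conj_at:
  assumes "\<sigma> \<in> complex_embeddings K0"
  shows "\<exists>x y. (x, y) \<in> sqrts \<and> (\<forall>z\<in>K0. \<sigma> z = complex_of_real (conj_at x y z))"
proof -
  have mult: "\<sigma> (a * b) = \<sigma> a * \<sigma> b" and add: "\<sigma> (a + b) = \<sigma> a + \<sigma> b" if "a \<in> K0" "b \<in> K0" for a b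
    using assms that ring_hom_mult ring_hom_add unfolding complex_embeddings_def by fastforce+
  have one: "\<sigma> 1 = 1"
    using assms ring_hom_one unfolding complex_embeddings_def by fastforce
  have rat0: "t \<in> K0" if "t \<in> \<rat>" for t
    using that by (rule generate_field_Rats)
  have zero: "\<sigma> 0 = 0" using add[of 0 0] rat0 by simp
  have nat: "\<sigma> (of_nat n) = of_nat n" for n
    by (induction n) (simp_all add: zero one add rat0)
  have uminus: "\<sigma> (- t) = - \<sigma> t" if "t \<in> \<rat>" for t
    using add[of t "- t"] that rat0 zero by (simp add: eq_neg_iff_add_eq_0 add.commute)
  have int: "\<sigma> (of_int n) = of_int n" for n
    by (cases n rule: int_cases2) (simp_all add: nat uminus)
  have rat: "\<sigma> t = complex_of_real t" if t: "t \<in> \<rat>" for t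
  proof -
    obtain a b where ab: "b > 0" "t = of_int a / of_int b"
      using Rats_cases'[OF t] by metis
    then have "\<sigma> (of_int b * t) = of_int a" using int by simp
    then have "of_int b * \<sigma> t = of_int a" using mult[of "of_int b" t] t rat0 int by simp
    then have "\<sigma> t = of_int a / of_int b" using ab(1) by (simp add: field_simps)
    then show ?thesis using ab by simp
  qed
  have root: "\<exists>x. x * x = c \<and> \<sigma> (sqrt c) = complex_of_real x" if "sqrt c \<in> K0" "c \<in> \<rat>" "c > 0" for c
  proof -
    have "\<sigma> (sqrt c) * \<sigma> (sqrt c) = complex_of_real c"
      using mult[OF that(1) that(1)] rat that by simp
    then have "(\<sigma> (sqrt c))\<^sup>2 = (complex_of_real (sqrt c))\<^sup>2"
      using that by (simp add: power2_eq_square flip: of_real_mult)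
    then have "\<sigma> (sqrt c) = complex_of_real (sqrt c) \<or> \<sigma> (sqrt c) = complex_of_real (- sqrt c)"
      by (simp add: power2_eq_iff)
    then show ?thesis using that(3) by (metis abs_of_pos mult_minus_left mult_minus_right minus_minus real_sqrt_mult_self)
  qed
  have "sqrt 6 \<in> K0" "sqrt 19 \<in> K0"
    unfolding adjoin_rats_def by (auto intro: generate_field.incl)
  note sq = this
  obtain x y where xy: "(x, y) \<in> sqrts" "\<sigma> (sqrt 6) = complex_of_real x" "\<sigma> (sqrt 19) = complex_of_real y"
    using root[OF sq(1)] root[OF sq(2)] by (auto simp: sqrts_def)
  have "\<sigma> z = complex_of_real (conj_at x y z)" if "z \<in> K0" for z
    using that
  proof (rule K0_cases)
    fix p q r s
    assume z: "z = biquad (sqrt 6) (sqrt 19) p q r s" and pq: "p \<in> \<rat>" "q \<in> \<rat>" "r \<in> \<rat>" "s \<in> \<rat>"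
    have "\<sigma> z = complex_of_real (biquad x y p q r s)"
      unfolding z biquad_def
      by (simp add: add mult rat0 rat pq sq K0_closed xy(2,3) del: real_sqrt_mult_self)
    then show ?thesis using z pq by (simp add: conj_at_biquad)
  qed
  with xy(1) show ?thesis by blast
qed

lemma totally_positive_iff:
  assumes "z \<in> K0"
  shows "totally_positive K0 z \<longleftrightarrow> (\<forall>x y. (x, y) \<in> sqrts \<longrightarrow> conj_at x y z > 0)"
proof
  assume "totally_positive K0 z"
  then show "\<forall>x y. (x, y) \<in> sqrts \<longrightarrow> conj_at x y z > 0"
    using conj_at_embedding unfolding totally_positive_def by fastforce
next
  assume "\<forall>x y. (x, y) \<in> sqrts \<longrightarrow> conj_at x y z > 0"
  then show "totally_positive K0 z"
    using complex_embedding_conj_at assms unfolding totally_positive_def by fastforce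
qed

section \<open>A suborder and denominators\<close>

text \<open>The order generated by \<open>sqrt 6\<close> and \<open>sqrt 19\<close>, of index 2 in
  the ring of integers. Unlike for the full ring, its closure properties and its invariance under
  conjugation can be read off from the coordinates.\<close>

definition biquad_order :: "real set" where
  "biquad_order = {biquad (sqrt 6) (sqrt 19) (of_int p) (of_int q) (of_int r) (of_int s) |p q r s. True}"

lemma biquad_order_I: "z = biquad (sqrt 6) (sqrt 19) (of_int p) (of_int q) (of_int r) (of_int s) \<Longrightarrow> z \<in> biquad_order"
  unfolding biquad_order_def by blast

lemma biquad_order_of_int [simp]: "of_int n \<in> biquad_order"
  by (rule biquad_order_I[of _ n 0 0 0]) (simp add: biquad_def)

lemma biquad_order_of_nat [simp]: "of_nat n \<in> biquad_order"
  using biquad_order_of_int[of "int n"] by simp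

lemma biquad_order_add:
  assumes "a \<in> biquad_order" "b \<in> biquad_order"
  shows "a + b \<in> biquad_order"
proof -
  obtain p q r s p' q' r' s' where "a = biquad (sqrt 6) (sqrt 19) (of_int p) (of_int q) (of_int r) (of_int s)"
    "b = biquad (sqrt 6) (sqrt 19) (of_int p') (of_int q') (of_int r') (of_int s')"
    using assms unfolding biquad_order_def by blast
  then have "a + b = biquad (sqrt 6) (sqrt 19)
      (of_int (p + p')) (of_int (q + q')) (of_int (r + r')) (of_int (s + s'))"
    by (simp add: biquad_add)
  then show ?thesis by (rule biquad_order_I)
qed

lemma biquad_order_mult:
  assumes "a \<in> biquad_order" "b \<in> biquad_order"
  shows "a * b \<in> biquad_order"
proof -
  obtain p q r s p' q' r' s' where "a = biquad (sqrt 6) (sqrt 19) (of_int p) (of_int q) (of_int r) (of_int s)"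
    "b = biquad (sqrt 6) (sqrt 19) (of_int p') (of_int q') (of_int r') (of_int s')"
    using assms unfolding biquad_order_def by blast
  then have "a * b = biquad (sqrt 6) (sqrt 19)
      (of_int (p * p' + 6 * q * q' + 19 * r * r' + 114 * s * s'))
      (of_int (p * q' + q * p' + 19 * (r * s' + s * r')))
      (of_int (p * r' + r * p' + 6 * (q * s' + s * q')))
      (of_int (p * s' + s * p' + q * r' + r * q'))"
    by (simp add: biquad_mult[OF std_sqrts])
  then show ?thesis by (rule biquad_order_I)
qed

lemma biquad_order_sum: "(\<And>i. i \<in> A \<Longrightarrow> f i \<in> biquad_order) \<Longrightarrow> sum f A \<in> biquad_order"
  using biquad_order_of_int[of 0] by (induction A rule: infinite_finite_induct) (auto intro: biquad_order_add)

lemma biquad_order_conj: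
  assumes "(x, y) \<in> sqrts" "a \<in> biquad_order"
  shows "conj_at x y a \<in> biquad_order"
proof -
  obtain p q r s where a: "a = biquad (sqrt 6) (sqrt 19) (of_int p) (of_int q) (of_int r) (of_int s)"
    using assms(2) unfolding biquad_order_def by blast
  then have "conj_at x y a = biquad x y (of_int p) (of_int q) (of_int r) (of_int s)"
    by (simp add: conj_at_biquad)
  moreover have "biquad (sqrt 6) (sqrt 19) (of_int p) (of_int q) (of_int r) (of_int s) \<in> biquad_order"
    "biquad (sqrt 6) (sqrt 19) (of_int p) (of_int (- q)) (of_int r) (of_int (- s)) \<in> biquad_order"
    "biquad (sqrt 6) (sqrt 19) (of_int p) (of_int q) (of_int (- r)) (of_int (- s)) \<in> biquad_order"
    "biquad (sqrt 6) (sqrt 19) (of_int p) (of_int (- q)) (of_int (- r)) (of_int s) \<in> biquad_order"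
    by (rule biquad_order_I[OF refl])+
  ultimately show ?thesis
    using assms(1) by (auto simp: sqrts_iff biquad_def)
qed

lemma biquad_order_denominator:
  assumes "z \<in> K0"
  shows "\<exists>d::nat. d > 0 \<and> of_nat d * z \<in> biquad_order"
proof -
  have denom: "\<exists>d::nat. d > 0 \<and> (\<exists>a. of_nat d * t = of_int a)" if t: "t \<in> \<rat>" for t :: real
  proof -
    obtain a b where "b > 0" "t = of_int a / of_int b"
      using Rats_cases'[OF t] by metis
    then show ?thesis by (intro exI[of _ "nat b"] conjI exI[of _ a]) auto
  qed
  obtain p q r s where z: "z = biquad (sqrt 6) (sqrt 19) p q r s"
    and rat: "p \<in> \<rat>" "q \<in> \<rat>" "r \<in> \<rat>" "s \<in> \<rat>"
    using assms by (rule K0_cases)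
  obtain d1 d2 d3 d4 :: nat and a1 a2 a3 a4 where d: "d1 > 0" "d2 > 0" "d3 > 0" "d4 > 0"
    and a: "of_nat d1 * p = of_int a1" "of_nat d2 * q = of_int a2" "of_nat d3 * r = of_int a3" "of_nat d4 * s = of_int a4"
    using rat[THEN denom] by blast
  have e: "of_nat (d1 * d2 * d3 * d4) * p = of_int (of_nat (d2 * d3 * d4) * a1)"
    "of_nat (d1 * d2 * d3 * d4) * q = of_int (of_nat (d1 * d3 * d4) * a2)"
    "of_nat (d1 * d2 * d3 * d4) * r = of_int (of_nat (d1 * d2 * d4) * a3)"
    "of_nat (d1 * d2 * d3 * d4) * s = of_int (of_nat (d1 * d2 * d3) * a4)"
    by (simp_all flip: a)
  have "of_nat D * z = biquad (sqrt 6) (sqrt 19) (of_nat D * p) (of_nat D * q) (of_nat D * r) (of_nat D * s)" for D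
    unfolding z biquad_def by (simp add: algebra_simps)
  from this[of "d1 * d2 * d3 * d4"] have "of_nat (d1 * d2 * d3 * d4) * z \<in> biquad_order"
    unfolding e by (rule biquad_order_I)
  moreover have "d1 * d2 * d3 * d4 > 0" using d by simp
  ultimately show ?thesis by blast
qed

lemma biquad_order_common_denominator:
  assumes "finite A" "A \<subseteq> K0"
  shows "\<exists>d::nat. d > 0 \<and> (\<forall>z\<in>A. of_nat d * z \<in> biquad_order)"
  using assms
proof (induction A rule: finite_induct)
  case (insert z A)
  then obtain d e :: nat where d: "d > 0" "\<forall>z\<in>A. of_nat d * z \<in> biquad_order" and e: "e > 0" "of_nat e * z \<in> biquad_order"
    using biquad_order_denominator[of z] by auto
  have "of_nat (d * e) * w \<in> biquad_order" if "w \<in> insert z A" for w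
  proof (cases "w = z")
    case True
    then show ?thesis using biquad_order_mult[OF biquad_order_of_nat[of d] e(2)] by (simp add: mult.assoc)
  next
    case False
    then show ?thesis using biquad_order_mult[OF biquad_order_of_nat[of e], of "of_nat d * w"] d(2) that by (simp add: mult_ac)
  qed
  then show ?case using d(1) e(1) by (intro exI[of _ "d * e"]) auto
qed auto

section \<open>Almost integral elements\<close>

definition almost_integral :: "real \<Rightarrow> bool" where
  "almost_integral z \<longleftrightarrow> (\<exists>d::nat. d > 0 \<and> (\<forall>k. of_nat d * z ^ k \<in> biquad_order))"

text \<open>A common denominator \<open>d\<close> of the powers below the degree serves all powers,
  since the monic equation writes a higher power as an integer combination of lower ones.\<close>

lemma algebraic_int_imp_almost_integral:
  assumes "z \<in> K0" "algebraic_int z"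
  shows "almost_integral z"
proof -
  obtain f where f: "lead_coeff f = 1" "\<And>i. coeff f i \<in> \<int>" "poly f z = 0"
    using assms(2) by (auto elim: algebraic_int.cases)
  define n where "n = degree f"
  obtain d :: nat where d: "d > 0" "\<And>k. k < n \<Longrightarrow> of_nat d * z ^ k \<in> biquad_order"
    using biquad_order_common_denominator[of "(\<lambda>k. z ^ k) ` {..<n}"] K0_closed(4)[OF assms(1)] by auto
  have "of_nat d * z ^ k \<in> biquad_order" for k
  proof (induction k rule: less_induct)
    case (less k)
    show ?case
    proof (cases "k < n")
      case False
      have "0 = (\<Sum>i<n. coeff f i * z ^ i) + z ^ n"
        using f(1,3) unfolding poly_altdef n_def by (simp add: lessThan_Suc_atMost[symmetric])
      then have zn: "z ^ n = - (\<Sum>i<n. coeff f i * z ^ i)" by simp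
      have "of_nat d * z ^ k = of_nat d * z ^ (k - n) * z ^ n"
        using False by (simp add: power_add[symmetric])
      also have "\<dots> = (\<Sum>i<n. - coeff f i * (of_nat d * z ^ (k - n + i)))"
        unfolding zn by (simp add: sum_distrib_left sum_negf power_add mult_ac)
      also have "\<dots> \<in> biquad_order"
      proof (rule biquad_order_sum, rule biquad_order_mult)
        fix i assume "i \<in> {..<n}"
        then show "of_nat d * z ^ (k - n + i) \<in> biquad_order" using False by (intro less) auto
        obtain c where "coeff f i = of_int c" using f(2)[of i] by (auto elim: Ints_cases)
        then show "- coeff f i \<in> biquad_order" using biquad_order_of_int[of "- c"] by simp
      qed
      finally show ?thesis .
    qed (use d in auto)
  qed
  then show ?thesis unfolding almost_integral_def using d(1) by blast
qed

lemma almost_integral_mult: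
  assumes "almost_integral a" "almost_integral b"
  shows "almost_integral (a * b)"
proof -
  obtain d e :: nat where d: "d > 0" "\<And>k. of_nat d * a ^ k \<in> biquad_order" and e: "e > 0" "\<And>k. of_nat e * b ^ k \<in> biquad_order"
    using assms unfolding almost_integral_def by blast
  have "of_nat (d * e) * (a * b) ^ k \<in> biquad_order" for k
    using biquad_order_mult[OF d(2)[of k] e(2)[of k]] by (simp add: power_mult_distrib mult_ac)
  then show ?thesis unfolding almost_integral_def using d(1) e(1) by (intro exI[of _ "d * e"]) auto
qed

text \<open>By the binomial theorem, \<open>d * e\<close> clears every term
  \<open>a ^ i * b ^ (k - i)\<close>.\<close>

lemma almost_integral_add:
  assumes "almost_integral a" "almost_integral b"
  shows "almost_integral (a + b)"
proof -
  obtain d e :: nat where d: "d > 0" "\<And>k. of_nat d * a ^ k \<in> biquad_order" and e: "e > 0" "\<And>k. of_nat e * b ^ k \<in> biquad_order"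
    using assms unfolding almost_integral_def by blast
  have "of_nat (d * e) * (a + b) ^ k = (\<Sum>i\<le>k. of_nat (k choose i) * ((of_nat d * a ^ i) * (of_nat e * b ^ (k - i))))" for k
    unfolding binomial_ring by (simp add: sum_distrib_left mult_ac)
  then have "of_nat (d * e) * (a + b) ^ k \<in> biquad_order" for k
    by (auto intro!: biquad_order_sum biquad_order_mult d e)
  then show ?thesis unfolding almost_integral_def using d(1) e(1) by (intro exI[of _ "d * e"]) auto
qed

lemma almost_integral_conj:
  assumes "(x, y) \<in> sqrts" "a \<in> K0" "almost_integral a"
  shows "almost_integral (conj_at x y a)"
proof -
  obtain d :: nat where d: "d > 0" "\<And>k. of_nat d * a ^ k \<in> biquad_order"
    using assms unfolding almost_integral_def by blast
  have "conj_at x y (of_nat d * a ^ k) = of_nat d * conj_at x y a ^ k" for k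
    using assms by (simp add: conj_at_mult conj_at_power conj_at_Rats K0_closed generate_field_Rats)
  then have "of_nat d * conj_at x y a ^ k \<in> biquad_order" for k
    using biquad_order_conj[OF assms(1) d(2)] by metis
  then show ?thesis unfolding almost_integral_def using d(1) by blast
qed

text \<open>In lowest terms every power of the denominator \<open>b\<close> divides
  \<open>d\<close>; the exponent \<open>d\<close> already forces \<open>b = 1\<close>, because
  \<open>2 ^ d\<close> exceeds \<open>d\<close>.\<close>

lemma almost_integral_Rats:
  assumes "t \<in> \<rat>" "almost_integral t"
  shows "t \<in> \<int>"
proof -
  obtain d :: nat where d: "d > 0" "\<And>k. of_nat d * t ^ k \<in> biquad_order"
    using assms unfolding almost_integral_def by blast
  obtain a b where ab: "b > 0" "coprime a b" "t = of_int a / of_int b"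
    using Rats_cases'[OF assms(1)] by metis
  have "b ^ k dvd int d" for k
  proof -
    obtain p q r s where "of_nat d * t ^ k = biquad (sqrt 6) (sqrt 19) (of_int p) (of_int q) (of_int r) (of_int s)"
      using d(2)[of k] unfolding biquad_order_def by blast
    \<comment> \<open>A rational element of the order is an integer by uniqueness of
      coordinates.\<close>
    then have "biquad (sqrt 6) (sqrt 19) (of_nat d * t ^ k) 0 0 0
        = biquad (sqrt 6) (sqrt 19) (of_int p) (of_int q) (of_int r) (of_int s)"
      by (simp add: biquad_def)
    from biquad_inj[OF std_sqrts this] have "of_nat d * t ^ k = of_int p"
      using assms(1) by simp
    then have "real_of_int (int d * a ^ k) = of_int (p * b ^ k)"
      using ab by (simp add: field_simps power_divide)
    then have "int d * a ^ k = p * b ^ k" by (simp only: of_int_eq_iff)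
    then have "b ^ k dvd int d * a ^ k" by simp
    moreover have "coprime (b ^ k) (a ^ k)" using ab(2) by (simp add: coprime_commute)
    ultimately show ?thesis by (simp add: coprime_dvd_mult_left_iff)
  qed
  from this[of d] have le: "b ^ d \<le> int d" using d(1) by (intro zdvd_imp_le) auto
  have "b = 1"
  proof (rule ccontr)
    assume "b \<noteq> 1"
    then have "2 ^ d \<le> b ^ d" using ab(1) by (intro power_mono) auto
    moreover have "int d < 2 ^ d" using less_exp[of d] by (metis of_nat_less_iff of_nat_numeral of_nat_power)
    ultimately show False using le by simp
  qed
  then show ?thesis using ab by simp
qed

section \<open>The ring of integers\<close>

type_synonym quad = "int \<times> int \<times> int \<times> int"

text \<open>Coordinates with respect to the integral basis: the value is
  \<open>a + b * x + c * y + d * (x + x * y) / 2\<close>.\<close>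

definition qval :: "real \<Rightarrow> real \<Rightarrow> quad \<Rightarrow> real" where
  "qval x y = (\<lambda>(a, b, c, d). biquad x y (of_int a) (of_int b + of_int d / 2) (of_int c) (of_int d / 2))"

text \<open>With \<open>\<omega> = (\<surd>6 + \<surd>114)/2\<close> the multiplication table is \<open>\<surd>6 \<omega> = 3 + 3 \<surd>19\<close>,
  \<open>\<surd>19 \<omega> = 9 \<surd>6 + \<omega>\<close>, \<open>\<surd>6 \<surd>19 = 2 \<omega> - \<surd>6\<close> and \<open>\<omega>\<^sup>2 = 30 + 3 \<surd>19\<close>.\<close>

fun qmul :: "quad \<Rightarrow> quad \<Rightarrow> quad" where
  "qmul (a, b, c, d) (a', b', c', d') =
    (a * a' + 6 * b * b' + 19 * c * c' + 30 * d * d' + 3 * (b * d' + d * b'),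
     a * b' + b * a' + 9 * (c * d' + d * c') - (b * c' + c * b'),
     a * c' + c * a' + 3 * (b * d' + d * b') + 3 * d * d',
     a * d' + d * a' + (c * d' + d * c') + 2 * (b * c' + c * b'))"

lemma qval_qmul:
  assumes "(x, y) \<in> sqrts"
  shows "qval x y (qmul u v) = qval x y u * qval x y v"
proof -
  obtain a b c d a' b' c' d' where uv: "u = (a, b, c, d)" "v = (a', b', c', d')"
    by (metis prod_cases4)
  define D D' :: real where "D = of_int d / 2" and "D' = of_int d' / 2"
  then have d: "of_int d = 2 * D" "of_int d' = 2 * D'" by simp_all
  show ?thesis
    unfolding uv qval_def qmul.simps prod.case biquad_mult[OF assms]
      of_int_add of_int_mult of_int_diff of_int_numeral d
    by (rule arg_cong4[where f = "biquad x y"]) (simp_all add: algebra_simps)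
qed

lemma qval_add:
  "qval x y (a, b, c, d) + qval x y (a', b', c', d') = qval x y (a + a', b + b', c + c', d + d')"
  by (simp add: qval_def biquad_add add_divide_distrib algebra_simps)

lemma qval_in_K0: "qval (sqrt 6) (sqrt 19) u \<in> K0"
  by (cases u) (auto simp: qval_def intro!: K0_I)

lemma conj_at_qval: "conj_at x y (qval (sqrt 6) (sqrt 19) u) = qval x y u"
  by (cases u) (simp add: qval_def conj_at_biquad)

text \<open>The element is a root of a monic quadratic whose coefficients, its relative trace and
  norm, are integer combinations of 1 and \<open>sqrt 6\<close>.\<close>

lemma algebraic_int_qval: "algebraic_int (qval (sqrt 6) (sqrt 19) u)"
proof -
  obtain a b c d where u: "u = (a, b, c, d)" by (metis prod_cases4)
  define z where "z = qval (sqrt 6) (sqrt 19) u"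
  define t t' where "t = 2 * a" and "t' = 2 * b + d"
  define n n' where "n = a * a + 6 * b * b + 6 * b * d - 19 * c * c - 27 * d * d"
    and "n' = 2 * a * b + a * d - 19 * c * d"
  have eq: "z * z - (of_int t + of_int t' * sqrt 6) * z + (of_int n + of_int n' * sqrt 6) = 0"
  proof -
    define D :: real where "D = of_int d / 2"
    then have d: "of_int d = 2 * D" by simp
    have "sqrt 6 * (sqrt 6 * w) = 6 * w" "sqrt 19 * (sqrt 19 * w) = 19 * w" for w :: real
      by (simp_all flip: mult.assoc)
    note sq = this
    show ?thesis
      unfolding z_def u qval_def biquad_def t_def t'_def n_def n'_def prod.case
        of_int_add of_int_mult of_int_diff of_int_numeral d
      by (simp add: sq algebra_simps)
  qed
  \<comment> \<open>The product of that quadratic with its conjugate under \<open>sqrt 6\<close> to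
    \<open>- sqrt 6\<close>, hence a monic integer quartic.\<close>
  define f :: "real poly" where "f = [:of_int n, - of_int t, 1:] ^ 2 - [:6:] * [:- of_int n', of_int t':] ^ 2"
  have "poly f z = (z * z - of_int t * z + of_int n)\<^sup>2 - 6 * (of_int t' * z - of_int n')\<^sup>2"
    unfolding f_def by (simp add: algebra_simps)
  also have "z * z - of_int t * z + of_int n = sqrt 6 * (of_int t' * z - of_int n')"
    using eq by (simp only: algebra_simps)
  finally have "poly f z = 0" by (simp add: power_mult_distrib)
  moreover have "f = [:of_int (n * n - 6 * n' * n'), of_int (12 * t' * n' - 2 * n * t), of_int (t * t + 2 * n - 6 * t' * t'), of_int (- 2 * t), 1:]"
    unfolding f_def by (simp add: power2_eq_square algebra_simps)
  ultimately show ?thesis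
    unfolding z_def[symmetric]
    by (intro algebraic_int.intros[of f]) (auto simp: coeff_pCons split: nat.splits)
qed

section \<open>Integrality of coordinates by congruences modulo 4\<close>

lemma square_mod_4: "(n::int) ^ 2 mod 4 = (if even n then 0 else 1)"
proof (cases "even n")
  case True
  then obtain k where "n = 2 * k" by blast
  then show ?thesis by (simp add: power2_eq_square)
next
  case False
  then obtain k where "n = 2 * k + 1" by (auto elim: oddE)
  then have "n ^ 2 = 4 * (k * k + k) + 1" by (simp add: power2_eq_square algebra_simps)
  then have "n ^ 2 mod 4 = 1" by presburger
  then show ?thesis using False by simp
qed

text \<open>The classical description of the integers of a quadratic field. Squarefreeness makes
  \<open>m = 2 * v\<close> an integer; with \<open>t = 2 * u\<close> the norm condition gives
  \<open>t ^ 2 = D * m ^ 2\<close> modulo 4, which for these \<open>D\<close> forces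
  \<open>t\<close> and \<open>m\<close> to be even.\<close>

lemma quadratic_integer:
  fixes u v :: real
  assumes "squarefree D" "D mod 4 = 2 \<or> D mod 4 = 3"
    and "u \<in> \<rat>" "v \<in> \<rat>" "2 * u \<in> \<int>" "u * u - of_int D * (v * v) \<in> \<int>"
  shows "u \<in> \<int>" "v \<in> \<int>"
proof -
  obtain t where t: "2 * u = of_int t" using assms(5) by (auto elim: Ints_cases)
  obtain n where n: "u * u - of_int D * (v * v) = of_int n" using assms(6) by (auto elim: Ints_cases)
  have "of_int D * (2 * v) ^ 2 = (2 * u) ^ 2 - 4 * (u * u - of_int D * (v * v))"
    by (simp add: power2_eq_square algebra_simps)
  then have *: "of_int D * (2 * v) ^ 2 = real_of_int (t ^ 2 - 4 * n)"
    unfolding t n by simp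
  have "of_int D * (2 * v) ^ 2 \<in> \<int>" unfolding * by (rule Ints_of_int)
  with assms(1) have "2 * v \<in> \<int>"
    using assms(4) by (intro Rats_int_multiple_square[of D "2 * v"] Rats_mult) simp_all
  then obtain m where m: "2 * v = of_int m" by (auto elim: Ints_cases)
  have eq: "D * m ^ 2 = t ^ 2 - 4 * n"
    using * unfolding m by (simp only: of_int_eq_iff flip: of_int_power of_int_mult)
  then have "t ^ 2 = D * m ^ 2 + 4 * n" by simp
  then have "t ^ 2 mod 4 = ((D mod 4) * (m ^ 2 mod 4)) mod 4"
    unfolding mod_mult_eq by simp
  then have "even t \<and> even m"
    using assms(2) by (auto simp: square_mod_4 split: if_splits)
  then obtain t' m' where "t = 2 * t'" "m = 2 * m'" by blast
  then have "u = of_int t'" "v = of_int m'" using t m by simp_all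
  then show "u \<in> \<int>" "v \<in> \<int>" by simp_all
qed

text \<open>The relative traces to the three quadratic subfields show that twice each coordinate is
  an integer. The relative norm to the subfield of \<open>sqrt 6\<close> then fixes the parities of
  these doubled coordinates.\<close>

lemma almost_integral_imp_qval:
  assumes "z \<in> K0" "almost_integral z"
  shows "z \<in> range (qval (sqrt 6) (sqrt 19))"
proof -
  obtain p q r s where z: "z = biquad (sqrt 6) (sqrt 19) p q r s"
    and rat: "p \<in> \<rat>" "q \<in> \<rat>" "r \<in> \<rat>" "s \<in> \<rat>"
    using assms(1) by (rule K0_cases)
  note s1 = sqrts_neg(1)[OF std_sqrts] and s2 = sqrts_neg(2)[OF std_sqrts] and s3 = sqrts_neg(3)[OF std_sqrts]
  have c: "biquad (sqrt 6) (- sqrt 19) p q r s = conj_at (sqrt 6) (- sqrt 19) z"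
    "biquad (- sqrt 6) (sqrt 19) p q r s = conj_at (- sqrt 6) (sqrt 19) z"
    "biquad (- sqrt 6) (- sqrt 19) p q r s = conj_at (- sqrt 6) (- sqrt 19) z"
    using rat by (simp_all add: z conj_at_biquad)
  have AI: "almost_integral (biquad x y p q r s)" if "(x, y) \<in> sqrts" for x y
    using almost_integral_conj[OF that assms] rat by (simp add: z conj_at_biquad)
  note i0 = AI[OF std_sqrts] and i1 = AI[OF s1] and i2 = AI[OF s2] and i3 = AI[OF s3]
  have Z: "w \<in> \<int>" if "almost_integral w'" "w' = w" "w \<in> \<rat>" for w w'
    using almost_integral_Rats that by blast
  note add = almost_integral_add and mult = almost_integral_mult
  \<comment> \<open>The absolute trace, in the form that \<open>quadratic_integer\<close> expects
    for \<open>u = 2 * p\<close>.\<close>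
  have T: "2 * (2 * p) \<in> \<int>"
    by (rule Z[OF add[OF add[OF i0 i1] add[OF i2 i3]]]) (use rat in \<open>simp_all add: biquad_def\<close>)
  \<comment> \<open>The norm of the relative trace \<open>2 * p + 2 * q * sqrt 6\<close>; the roots
    of 19 and 114 are treated alike below.\<close>
  have "2 * p * (2 * p) - of_int 6 * (2 * q * (2 * q)) \<in> \<int>"
  proof (rule Z[OF mult[OF add[OF i0 i2] add[OF i1 i3]]])
    have "biquad (sqrt 6) (sqrt 19) p q r s + biquad (sqrt 6) (- sqrt 19) p q r s = 2 * p + 2 * q * sqrt 6"
      "biquad (- sqrt 6) (sqrt 19) p q r s + biquad (- sqrt 6) (- sqrt 19) p q r s = 2 * p - 2 * q * sqrt 6"
      by (simp_all add: biquad_def)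
    moreover have "(2 * p + 2 * q * w) * (2 * p - 2 * q * w) = 2 * p * (2 * p) - (w * w) * (2 * q * (2 * q))" for w :: real
      by (simp add: algebra_simps)
    ultimately show "(biquad (sqrt 6) (sqrt 19) p q r s + biquad (sqrt 6) (- sqrt 19) p q r s) *
      (biquad (- sqrt 6) (sqrt 19) p q r s + biquad (- sqrt 6) (- sqrt 19) p q r s) = 2 * p * (2 * p) - of_int 6 * (2 * q * (2 * q))"
      by simp
  qed (use rat in simp)
  from quadratic_integer[OF squarefree_numerals(1) _ _ _ T this] rat
  have pq: "2 * p \<in> \<int>" "2 * q \<in> \<int>" by simp_all
  have "2 * p * (2 * p) - of_int 19 * (2 * r * (2 * r)) \<in> \<int>"
  proof (rule Z[OF mult[OF add[OF i0 i1] add[OF i2 i3]]])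
    have "biquad (sqrt 6) (sqrt 19) p q r s + biquad (- sqrt 6) (sqrt 19) p q r s = 2 * p + 2 * r * sqrt 19"
      "biquad (sqrt 6) (- sqrt 19) p q r s + biquad (- sqrt 6) (- sqrt 19) p q r s = 2 * p - 2 * r * sqrt 19"
      by (simp_all add: biquad_def)
    moreover have "(2 * p + 2 * r * w) * (2 * p - 2 * r * w) = 2 * p * (2 * p) - (w * w) * (2 * r * (2 * r))" for w :: real
      by (simp add: algebra_simps)
    ultimately show "(biquad (sqrt 6) (sqrt 19) p q r s + biquad (- sqrt 6) (sqrt 19) p q r s) *
      (biquad (sqrt 6) (- sqrt 19) p q r s + biquad (- sqrt 6) (- sqrt 19) p q r s) = 2 * p * (2 * p) - of_int 19 * (2 * r * (2 * r))"
      by simp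
  qed (use rat in simp)
  from quadratic_integer[OF squarefree_numerals(2) _ _ _ T this] rat
  have r: "2 * r \<in> \<int>" by simp
  have "2 * p * (2 * p) - of_int 114 * (2 * s * (2 * s)) \<in> \<int>"
  proof (rule Z[OF mult[OF add[OF i0 i3] add[OF i1 i2]]])
    have "biquad (sqrt 6) (sqrt 19) p q r s + biquad (- sqrt 6) (- sqrt 19) p q r s = 2 * p + 2 * s * (sqrt 6 * sqrt 19)"
      "biquad (- sqrt 6) (sqrt 19) p q r s + biquad (sqrt 6) (- sqrt 19) p q r s = 2 * p - 2 * s * (sqrt 6 * sqrt 19)"
      by (simp_all add: biquad_def)
    moreover have "(2 * p + 2 * s * w) * (2 * p - 2 * s * w) = 2 * p * (2 * p) - (w * w) * (2 * s * (2 * s))" for w :: real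
      by (simp add: algebra_simps)
    moreover have "(sqrt 6 * sqrt 19) * (sqrt 6 * sqrt 19) = (114::real)"
      by (simp flip: real_sqrt_mult)
    ultimately show "(biquad (sqrt 6) (sqrt 19) p q r s + biquad (- sqrt 6) (- sqrt 19) p q r s) *
      (biquad (- sqrt 6) (sqrt 19) p q r s + biquad (sqrt 6) (- sqrt 19) p q r s) = 2 * p * (2 * p) - of_int 114 * (2 * s * (2 * s))"
      by simp
  qed (use rat in simp)
  from quadratic_integer[OF squarefree_numerals(3) _ _ _ T this] rat
  have s: "2 * s \<in> \<int>" by simp
  obtain P Q R S where PQRS: "2 * p = of_int P" "2 * q = of_int Q" "2 * r = of_int R" "2 * s = of_int S"
    using pq r s by (auto elim!: Ints_cases)
  \<comment> \<open>\<open>A + B * sqrt 6\<close> is the relative norm of \<open>z\<close>.\<close>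
  define A where "A = p * p + 6 * (q * q) - 19 * (r * r) - 114 * (s * s)"
  define B where "B = 2 * (p * q) - 38 * (r * s)"
  have ratAB: "A \<in> \<rat>" "B \<in> \<rat>" unfolding A_def B_def using rat by simp_all
  have sq: "sqrt 6 * (sqrt 6 * w) = 6 * w" "sqrt 19 * (sqrt 19 * w) = 19 * w" for w :: real
    by (simp_all flip: mult.assoc)
  have N: "biquad (sqrt 6) (sqrt 19) p q r s * biquad (sqrt 6) (- sqrt 19) p q r s = A + B * sqrt 6"
    "biquad (- sqrt 6) (sqrt 19) p q r s * biquad (- sqrt 6) (- sqrt 19) p q r s = A - B * sqrt 6"
    unfolding biquad_def A_def B_def by (simp_all add: sq algebra_simps)
  have A2: "2 * A \<in> \<int>"
    by (rule Z[OF add[OF mult[OF i0 i2] mult[OF i1 i3]]]) (use ratAB in \<open>simp_all add: N\<close>)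
  have "A * A - of_int 6 * (B * B) \<in> \<int>"
  proof (rule Z[OF mult[OF mult[OF i0 i2] mult[OF i1 i3]]])
    have "(A + B * w) * (A - B * w) = A * A - (w * w) * (B * B)" for w :: real
      by (simp add: algebra_simps)
    then show "biquad (sqrt 6) (sqrt 19) p q r s * biquad (sqrt 6) (- sqrt 19) p q r s *
     (biquad (- sqrt 6) (sqrt 19) p q r s * biquad (- sqrt 6) (- sqrt 19) p q r s) = A * A - of_int 6 * (B * B)"
      unfolding N by simp
  qed (use ratAB in simp)
  from quadratic_integer[OF squarefree_numerals(1) _ ratAB A2 this]
  have "A \<in> \<int>" "B \<in> \<int>" by simp_all
  then obtain m n where mn: "A = of_int m" "B = of_int n" by (auto elim!: Ints_cases)
  have "(2 * p) * (2 * p) + 6 * ((2 * q) * (2 * q)) - 19 * ((2 * r) * (2 * r)) - 114 * ((2 * s) * (2 * s)) = 4 * of_int m"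
    "(2 * p) * (2 * q) - 19 * ((2 * r) * (2 * s)) = 2 * of_int n"
    unfolding mn[symmetric] A_def B_def by simp_all
  then have "real_of_int (P\<^sup>2 + 6 * Q\<^sup>2 - 19 * R\<^sup>2 - 114 * S\<^sup>2) = of_int (4 * m)"
    "real_of_int (P * Q - 19 * (R * S)) = of_int (2 * n)"
    unfolding PQRS by (simp_all add: power2_eq_square)
  then have PQ: "P\<^sup>2 + 6 * Q\<^sup>2 - 19 * R\<^sup>2 - 114 * S\<^sup>2 = 4 * m" "P * Q - 19 * (R * S) = 2 * n"
    by (simp_all only: of_int_eq_iff)
  have "even (P * Q - 19 * (R * S))" using PQ(2) by simp
  then have ev: "(even P \<or> even Q) \<longleftrightarrow> (even R \<or> even S)" by simp
  define \<epsilon> :: "int \<Rightarrow> int" where "\<epsilon> k = (if even k then 0 else 1)" for k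
  have "\<exists>h. k\<^sup>2 = 4 * h + \<epsilon> k" for k
    using square_mod_4[of k] mult_div_mod_eq[of 4 "k\<^sup>2"] by (intro exI[of _ "k\<^sup>2 div 4"]) (simp add: \<epsilon>_def)
  then obtain h1 h2 h3 h4 where sq4: "P\<^sup>2 = 4 * h1 + \<epsilon> P" "Q\<^sup>2 = 4 * h2 + \<epsilon> Q"
    "R\<^sup>2 = 4 * h3 + \<epsilon> R" "S\<^sup>2 = 4 * h4 + \<epsilon> S" by meson
  define M where "M = m - h1 - 6 * h2 + 19 * h3 + 114 * h4"
  have "\<epsilon> P + 6 * \<epsilon> Q - 19 * \<epsilon> R - 114 * \<epsilon> S = 4 * M"
    using PQ(1) unfolding sq4 M_def by (simp add: algebra_simps)
  \<comment> \<open>Modulo 4 the sum of the four terms is \<open>\<epsilon> P + \<epsilon> R + 2 *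
    (\<epsilon> Q + \<epsilon> S)\<close>. Apart from the desired parities it vanishes only for
    \<open>P\<close>, \<open>R\<close> odd and \<open>Q\<close>, \<open>S\<close> of opposite
    parity, with values -12 and -132; these two cases contradict \<open>ev\<close>.\<close>
  moreover have "4 * M \<noteq> 1" "4 * M \<noteq> -1" "4 * M \<noteq> 6" "4 * M \<noteq> 2" "4 * M \<noteq> -18"  "4 * M \<noteq> -114"
    "4 * M \<noteq> 7" "4 * M \<noteq> -19" "4 * M \<noteq> -13" "4 * M \<noteq> -127" "4 * M \<noteq> -126"
    by presburger+
  ultimately have "even P \<and> even R \<and> (even Q \<longleftrightarrow> even S)"
    using ev unfolding \<epsilon>_def by (auto split: if_splits)
  then have "even P" "even R" "even (Q - S)" by simp_all
  then obtain a c b where "P = 2 * a" "R = 2 * c" "Q - S = 2 * b"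
    by (elim dvdE)
  then have abc: "P = 2 * a" "R = 2 * c" "Q = 2 * b + S" by simp_all
  have "p = of_int a" "r = of_int c" "s = of_int S / 2" "2 * q = 2 * of_int b + of_int S"
    using PQRS unfolding abc by simp_all
  moreover from this(4) have "q = of_int b + of_int S / 2" by simp
  ultimately have "p = of_int a" "q = of_int b + of_int S / 2" "r = of_int c" "s = of_int S / 2"
    by simp_all
  then have "z = qval (sqrt 6) (sqrt 19) (a, b, c, S)"
    by (simp only: z qval_def prod.case)
  then show ?thesis by blast
qed

lemma ring_of_integers_K0: "ring_of_integers K0 = range (qval (sqrt 6) (sqrt 19))"
  unfolding ring_of_integers_def
  using almost_integral_imp_qval algebraic_int_imp_almost_integral qval_in_K0 algebraic_int_qval by blast

lemma ring_of_integers_K0_closed: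
  assumes "a \<in> ring_of_integers K0" "b \<in> ring_of_integers K0"
  shows "a + b \<in> ring_of_integers K0" "a * b \<in> ring_of_integers K0" "- a \<in> ring_of_integers K0"
proof -
  obtain u v where uv: "a = qval (sqrt 6) (sqrt 19) u" "b = qval (sqrt 6) (sqrt 19) v"
    using assms unfolding ring_of_integers_K0 by blast
  obtain a1 a2 a3 a4 b1 b2 b3 b4 where u: "u = (a1, a2, a3, a4)" "v = (b1, b2, b3, b4)"
    by (metis prod_cases4)
  show "a + b \<in> ring_of_integers K0"
    unfolding ring_of_integers_K0 uv u qval_add by simp
  show "a * b \<in> ring_of_integers K0"
    unfolding ring_of_integers_K0 uv qval_qmul[OF std_sqrts, symmetric] by simp
  have "- a = qval (sqrt 6) (sqrt 19) (- a1, - a2, - a3, - a4)"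
    unfolding uv u by (simp add: qval_def biquad_def algebra_simps)
  then show "- a \<in> ring_of_integers K0"
    unfolding ring_of_integers_K0 by simp
qed

section \<open>Squares dominated by a product\<close>

lemma qval_eq_0: "qval (sqrt 6) (sqrt 19) u = 0 \<longleftrightarrow> u = (0, 0, 0, 0)"
proof
  obtain a b c d where u: "u = (a, b, c, d)" by (metis prod_cases4)
  assume "qval (sqrt 6) (sqrt 19) u = 0"
  then have "biquad (sqrt 6) (sqrt 19) (of_int a) (of_int b + of_int d / 2) (of_int c) (of_int d / 2) = 0"
    by (simp add: u qval_def)
  from biquad_eq_0[OF std_sqrts _ _ _ _ this] show "u = (0, 0, 0, 0)" by (simp add: u)
qed (simp add: qval_def biquad_def)

section \<open>Sign conditions at all embeddings by integer arithmetic\<close>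

fun qsub :: "quad \<Rightarrow> quad \<Rightarrow> quad" where
  "qsub (a, b, c, d) (a', b', c', d') = (a - a', b - b', c - c', d - d')"

lemma qval_qsub: "qval x y (qsub u v) = qval x y u - qval x y v"
  by (cases u; cases v) (simp add: qval_def biquad_def diff_divide_distrib algebra_simps)

text \<open>Four times the relative norm to \<open>\<rat>(\<surd>6)\<close>. An element is positive at all real embeddings iff
  this norm and the relative trace are, and for \<open>A + B \<surd>6\<close> this means \<open>A > 0\<close> and \<open>6 B\<^sup>2 < A\<^sup>2\<close>.\<close>

fun qnorm6 :: "quad \<Rightarrow> int \<times> int" where
  "qnorm6 (a, b, c, d) = (let q = 2 * b + d
     in (4 * a * a + 6 * q * q - 76 * c * c - 114 * d * d, 4 * a * q - 76 * c * d))"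

fun qnonneg :: "quad \<Rightarrow> bool" where
  "qnonneg (a, b, c, d) \<longleftrightarrow> 0 \<le> a \<and> 6 * (2 * b + d) ^ 2 \<le> (2 * a) ^ 2 \<and>
     (case qnorm6 (a, b, c, d) of (A, B) \<Rightarrow> 0 \<le> A \<and> 6 * B ^ 2 \<le> A ^ 2)"

fun qpos :: "quad \<Rightarrow> bool" where
  "qpos (a, b, c, d) \<longleftrightarrow> 0 < a \<and> 6 * (2 * b + d) ^ 2 < (2 * a) ^ 2 \<and>
     (case qnorm6 (a, b, c, d) of (A, B) \<Rightarrow> 0 < A \<and> 6 * B ^ 2 < A ^ 2)"

text \<open>Relative trace and norm to the subfield of \<open>sqrt 6\<close>; the factors 2 clear
  the halves in the basis.\<close>

lemma qval_sum_prod: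
  assumes "(x, y) \<in> sqrts" "qnorm6 (a, b, c, d) = (A, B)"
  shows "2 * qval x y (a, b, c, d) + 2 * qval x (- y) (a, b, c, d) = 2 * (of_int (2 * a) + of_int (2 * b + d) * x)"
    "(2 * qval x y (a, b, c, d)) * (2 * qval x (- y) (a, b, c, d)) = of_int A + of_int B * x"
proof -
  have sq: "x * x = 6" "y * y = 19" using assms(1) by (auto simp: sqrts_def)
  have sq': "x * (x * z) = 6 * z" "y * (y * z) = 19 * z" for z
    by (simp_all add: sq flip: mult.assoc)
  define D :: real where "D = of_int d / 2"
  then have d: "of_int d = 2 * D" by simp
  show "2 * qval x y (a, b, c, d) + 2 * qval x (- y) (a, b, c, d) = 2 * (of_int (2 * a) + of_int (2 * b + d) * x)"
    unfolding qval_def biquad_def prod.case of_int_add of_int_mult of_int_numeral d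
    by (simp add: algebra_simps)
  have AB: "A = 4 * a * a + 6 * (2 * b + d) * (2 * b + d) - 76 * c * c - 114 * d * d" "B = 4 * a * (2 * b + d) - 76 * c * d"
    using assms(2) by (simp_all add: Let_def)
  show "(2 * qval x y (a, b, c, d)) * (2 * qval x (- y) (a, b, c, d)) = of_int A + of_int B * x"
    unfolding AB qval_def biquad_def prod.case of_int_add of_int_mult of_int_diff of_int_numeral d
    by (simp add: sq sq' algebra_simps)
qed

lemma conj_pair_nonneg:
  fixes p q :: int and x :: real
  assumes "x * x = 6" "0 \<le> of_int p + of_int q * x" "0 \<le> of_int p - of_int q * x"
  shows "0 \<le> p \<and> 6 * q ^ 2 \<le> p ^ 2"
proof -
  have "0 \<le> (of_int p + of_int q * x) * (of_int p - of_int q * x)"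
    using assms(2,3) by (rule mult_nonneg_nonneg)
  also have "\<dots> = of_int p ^ 2 - of_int q ^ 2 * (x * x)"
    by (simp add: algebra_simps power2_eq_square)
  also have "\<dots> = real_of_int (p ^ 2 - 6 * q ^ 2)"
    by (simp add: assms(1))
  finally have "6 * q ^ 2 \<le> p ^ 2" by (simp only: of_int_0_le_iff diff_ge_0_iff_ge)
  then show ?thesis using assms(2,3) by auto
qed

lemma sum_prod_pos:
  fixes a b :: real
  assumes "0 < a + b" "0 < a * b"
  shows "0 < a \<and> 0 < b"
  using assms by (auto simp: zero_less_mult_iff)

lemma conj_pair_pos:
  fixes p q :: int and x :: real
  assumes "x * x = 6" "0 < p" "6 * q ^ 2 < p ^ 2"
  shows "0 < of_int p + of_int q * x"
proof -
  have "(of_int p + of_int q * x) * (of_int p - of_int q * x) = of_int p ^ 2 - of_int q ^ 2 * (x * x)"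
    by (simp add: algebra_simps power2_eq_square)
  also have "\<dots> = real_of_int (p ^ 2 - 6 * q ^ 2)"
    by (simp add: assms(1))
  also have "\<dots> > 0" unfolding of_int_0_less_iff using assms(3) by simp
  finally show ?thesis
    using sum_prod_pos[of "of_int p + of_int q * x" "of_int p - of_int q * x"] assms(2) by simp
qed

text \<open>The direction needed for exclusion: an element failing the integer test is negative at
  some embedding.\<close>

lemma qnonnegI:
  assumes "\<And>x y. (x, y) \<in> sqrts \<Longrightarrow> 0 \<le> qval x y u"
  shows "qnonneg u"
proof -
  obtain a b c d where u: "u = (a, b, c, d)" by (metis prod_cases4)
  obtain A B where AB: "qnorm6 (a, b, c, d) = (A, B)" by fastforce
  have 1: "0 \<le> of_int (2 * a) + of_int (2 * b + d) * x" "0 \<le> of_int A + of_int B * x" if "(x, sqrt 19) \<in> sqrts" for x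
  proof -
    have nonneg: "0 \<le> 2 * qval x (sqrt 19) (a, b, c, d)" "0 \<le> 2 * qval x (- sqrt 19) (a, b, c, d)"
      using assms[OF that] assms[OF sqrts_neg(2)[OF that]] by (simp_all add: u)
    show "0 \<le> of_int (2 * a) + of_int (2 * b + d) * x"
      using add_nonneg_nonneg[OF nonneg] unfolding qval_sum_prod(1)[OF that AB] by simp
    show "0 \<le> of_int A + of_int B * x"
      using mult_nonneg_nonneg[OF nonneg] unfolding qval_sum_prod(2)[OF that AB] .
  qed
  note 2 = 1[OF std_sqrts] 1[OF sqrts_neg(1)[OF std_sqrts]]
  have "0 \<le> 2 * a \<and> 6 * (2 * b + d) ^ 2 \<le> (2 * a) ^ 2" "0 \<le> A \<and> 6 * B ^ 2 \<le> A ^ 2"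
    by (rule conj_pair_nonneg[of "sqrt 6"]; use 2 in simp)+
  then show ?thesis by (simp add: u AB del: qnorm6.simps)
qed

text \<open>Two conjugates with positive sum and positive product are both positive; this is applied
  over the rationals and then over the subfield of \<open>sqrt 6\<close>.\<close>

lemma qposD:
  assumes "qpos u" "(x, y) \<in> sqrts"
  shows "0 < qval x y u"
proof -
  obtain a b c d where u: "u = (a, b, c, d)" by (metis prod_cases4)
  obtain A B where AB: "qnorm6 (a, b, c, d) = (A, B)" by fastforce
  have x: "x * x = 6" using assms(2) by (auto simp: sqrts_def)
  have "0 < 2 * a" "6 * (2 * b + d) ^ 2 < (2 * a) ^ 2" "0 < A" "6 * B ^ 2 < A ^ 2"
    using assms(1) by (simp_all add: u AB del: qnorm6.simps)
  then have "0 < real_of_int (2 * a) + of_int (2 * b + d) * x" "0 < of_int A + of_int B * x"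
    using conj_pair_pos[OF x] by blast+
  then have "0 < 2 * qval x y u \<and> 0 < 2 * qval x (- y) u"
    using qval_sum_prod[OF assms(2) AB]
    by (intro sum_prod_pos) (simp_all only: u zero_less_mult_iff[of 2] zero_less_numeral simp_thms)
  then show ?thesis by simp
qed

text \<open>The box contains every \<open>g\<close> for which the first coordinate of \<open>g\<^sup>2\<close> is at most \<open>40\<close>.\<close>

definition dominates_no_square :: "quad \<Rightarrow> bool" where
  "dominates_no_square u \<longleftrightarrow> (\<forall>d\<in>set [-1..1]. \<forall>c\<in>set [-1..1]. \<forall>b\<in>set [-3..3]. \<forall>a\<in>set [-6..6].
     qnonneg (qsub u (qmul (a, b, c, d) (a, b, c, d))) \<longrightarrow> (a, b, c, d) = (0, 0, 0, 0))"

lemma int_bounds_if_square_less: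
  fixes x k :: int
  assumes "x\<^sup>2 < (k + 1)\<^sup>2" "0 \<le> k"
  shows "- k \<le> x \<and> x \<le> k"
  using abs_le_square_iff[of "k + 1" x] assms by auto

text \<open>The first coordinate is a quarter of the trace, the other basis elements having trace 0.
  So the first coordinate \<open>e\<close> of the square of \<open>g\<close> is at most
  \<open>fst u\<close>, which puts \<open>g\<close> into the box.\<close>

lemma dominates_no_squareD:
  assumes "dominates_no_square u" "fst u \<le> 40" "qnonneg (qsub u (qmul g g))"
  shows "g = (0, 0, 0, 0)"
proof -
  obtain a b c d where g: "g = (a, b, c, d)" by (metis prod_cases4)
  obtain u1 u2 u3 u4 where u: "u = (u1, u2, u3, u4)" by (metis prod_cases4)
  define e where "e = a * a + 6 * b * b + 19 * c * c + 30 * d * d + 6 * b * d"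
  have "e \<le> 40"
    using assms(2,3) by (simp add: g u e_def algebra_simps del: qnorm6.simps)
  \<comment> \<open>Completing the square in \<open>b\<close> diagonalises the trace form.\<close>
  moreover have "2 * e = 2 * a\<^sup>2 + 3 * (2 * b + d)\<^sup>2 + 38 * c\<^sup>2 + 57 * d\<^sup>2"
    by (simp add: e_def power2_eq_square algebra_simps)
  ultimately have le: "2 * a\<^sup>2 + 3 * (2 * b + d)\<^sup>2 + 38 * c\<^sup>2 + 57 * d\<^sup>2 \<le> 80" by linarith
  have nn: "0 \<le> a\<^sup>2" "0 \<le> (2 * b + d)\<^sup>2" "0 \<le> c\<^sup>2" "0 \<le> d\<^sup>2" by simp_all
  have "a\<^sup>2 < (6 + 1)\<^sup>2" "(2 * b + d)\<^sup>2 < (5 + 1)\<^sup>2" "c\<^sup>2 < (1 + 1)\<^sup>2" "d\<^sup>2 < (1 + 1)\<^sup>2"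
  proof -
    have "A < 49 \<and> B < 36 \<and> C < 4 \<and> D < 4"
      if "2 * A + 3 * B + 38 * C + 57 * D \<le> 80" "0 \<le> A" "0 \<le> B" "0 \<le> C" "0 \<le> D" for A B C D :: int
      using that by linarith
    from this[OF le nn] show "a\<^sup>2 < (6 + 1)\<^sup>2" "(2 * b + d)\<^sup>2 < (5 + 1)\<^sup>2" "c\<^sup>2 < (1 + 1)\<^sup>2" "d\<^sup>2 < (1 + 1)\<^sup>2"
      by simp_all
  qed
  then have "- 6 \<le> a \<and> a \<le> 6" "- 5 \<le> 2 * b + d \<and> 2 * b + d \<le> 5" "- 1 \<le> c \<and> c \<le> 1" "- 1 \<le> d \<and> d \<le> 1"
    by (intro int_bounds_if_square_less; simp)+
  then have "a \<in> set [-6..6]" "b \<in> set [-3..3]" "c \<in> set [-1..1]" "d \<in> set [-1..1]"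
    by auto
  then show ?thesis
    using assms(1,3) unfolding dominates_no_square_def g by blast
qed

text \<open>Multiplying the inequality by the square of \<open>m\<close> moves \<open>m * g\<close>
  into the box, so that \<open>m * g = 0\<close>; cancelling \<open>m\<close> needs only that it is
  nonzero.\<close>

lemma no_common_square:
  assumes "dominates_no_square (qmul (qmul m m) (qmul u v))" "fst (qmul (qmul m m) (qmul u v)) \<le> 40"
    and "m \<noteq> (0, 0, 0, 0)"
    and g: "\<And>x y. (x, y) \<in> sqrts \<Longrightarrow> (qval x y g)\<^sup>2 \<le> qval x y u * qval x y v"
  shows "g = (0, 0, 0, 0)"
proof -
  have "qnonneg (qsub (qmul (qmul m m) (qmul u v)) (qmul (qmul m g) (qmul m g)))"
  proof (rule qnonnegI)
    fix x y assume xy: "(x, y) \<in> sqrts"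
    have "(qval x y m)\<^sup>2 * (qval x y g)\<^sup>2 \<le> (qval x y m)\<^sup>2 * (qval x y u * qval x y v)"
      by (intro mult_left_mono g xy) simp
    then show "0 \<le> qval x y (qsub (qmul (qmul m m) (qmul u v)) (qmul (qmul m g) (qmul m g)))"
      by (simp add: qval_qsub qval_qmul[OF xy] power2_eq_square mult_ac)
  qed
  from dominates_no_squareD[OF assms(1,2) this] have "qval (sqrt 6) (sqrt 19) m * qval (sqrt 6) (sqrt 19) g = 0"
    by (simp add: qval_eq_0 flip: qval_qmul[OF std_sqrts])
  then show ?thesis using assms(3) by (simp add: qval_eq_0)
qed

definition pairs :: "(quad \<times> quad \<times> quad) list" where
  "pairs = 
   [((1, 0, 0, 0), (5, 2, 0, 0), (5, -2, 0, 0)),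
    ((1, 0, 0, 0), (53, 7, 12, 4), (13, -8, -3, 3)),
    ((1, 0, 0, 0), (32, 9, 7, 5), (1, 0, 0, 0)),
    ((1, 0, 0, 0), (97, -46, -22, 17), (13, 5, 3, 3)),
    ((1, 0, 0, 0), (131, 51, -30, -19), (13, -5, 3, -3)),
    ((5, 2, 0, 0), (53, 7, 12, 4), (143, -72, -33, 27)),
    ((5, 2, 0, 0), (32, 9, 7, 5), (5, -2, 0, 0)),
    ((5, 2, 0, 0), (97, -46, -22, 17), (13, 5, 3, 3)),
    ((5, 2, 0, 0), (131, 51, -30, -19), (13, -5, 3, -3)),
    ((53, 7, 12, 4), (32, 9, 7, 5), (13, -8, -3, 3)),
    ((53, 7, 12, 4), (97, -46, -22, 17), (1, 0, 0, 0)),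
    ((53, 7, 12, 4), (131, 51, -30, -19), (5, -2, 0, 0)),
    ((32, 9, 7, 5), (97, -46, -22, 17), (1, 0, 0, 0)),
    ((32, 9, 7, 5), (131, 51, -30, -19), (5, -2, 0, 0)),
    ((97, -46, -22, 17), (131, 51, -30, -19), (13, 5, 3, 3))]"

section \<open>Orthogonal vectors\<close>

text \<open>Gaussian elimination, one coordinate at a time.\<close>

lemma linear_dependence:
  fixes v :: "'a \<Rightarrow> 'b \<Rightarrow> 'c::field"
  assumes "finite I" "finite S" "card I < card S"
  shows "\<exists>c. (\<exists>k\<in>S. c k \<noteq> 0) \<and> (\<forall>i\<in>I. (\<Sum>k\<in>S. c k * v k i) = 0)"
  using assms
proof (induction I arbitrary: S v rule: finite_induct)
  case empty
  then obtain k where "k \<in> S" by fastforce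
  then show ?case by (intro exI[of _ "\<lambda>_. 1"]) auto
next
  case (insert j I)
  show ?case
  proof (cases "\<forall>k\<in>S. v k j = 0")
    case True
    obtain c where "\<exists>k\<in>S. c k \<noteq> 0" "\<forall>i\<in>I. (\<Sum>k\<in>S. c k * v k i) = 0"
      using insert.IH[of S v] insert.prems insert.hyps by auto
    then show ?thesis using True by (intro exI[of _ c]) auto
  next
    case False
    then obtain l where l: "l \<in> S" "v l j \<noteq> 0" by blast
    \<comment> \<open>The vector \<open>v l\<close> is the pivot that clears coordinate
      \<open>j\<close>. The coefficient \<open>- t\<close> of \<open>v l\<close> below collects what
      was subtracted.\<close>
    define w where "w k i = v k i - v k j / v l j * v l i" for k i
    obtain c where c: "\<exists>k\<in>S - {l}. c k \<noteq> 0" "\<forall>i\<in>I. (\<Sum>k\<in>S - {l}. c k * w k i) = 0"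
      using insert.IH[of "S - {l}" w] insert.prems insert.hyps l
      by (auto simp: less_diff_conv)
    define t where "t = (\<Sum>k\<in>S - {l}. c k * (v k j / v l j))"
    define c' where "c' = c(l := - t)"
    have sum: "(\<Sum>k\<in>S. c' k * v k i) = (\<Sum>k\<in>S - {l}. c k * w k i)" for i
    proof -
      have "(\<Sum>k\<in>S. c' k * v k i) = c' l * v l i + (\<Sum>k\<in>S - {l}. c' k * v k i)"
        using l insert.prems by (simp add: sum.remove)
      also have "(\<Sum>k\<in>S - {l}. c' k * v k i) = (\<Sum>k\<in>S - {l}. c k * v k i)"
        by (intro sum.cong) (auto simp: c'_def)
      also have "c' l * v l i = - (\<Sum>k\<in>S - {l}. c k * (v k j / v l j * v l i))"
        by (simp add: c'_def t_def sum_distrib_right mult.assoc)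
      finally show ?thesis
        by (simp add: w_def right_diff_distrib sum_subtractf)
    qed
    have "(\<Sum>k\<in>S. c' k * v k i) = 0" if "i \<in> insert j I" for i
    proof (cases "i = j")
      case True
      then show ?thesis unfolding sum using l by (simp add: w_def)
    next
      case False
      then show ?thesis unfolding sum using c(2) that by simp
    qed
    moreover have "\<exists>k\<in>S. c' k \<noteq> 0" using c(1) by (auto simp: c'_def)
    ultimately show ?thesis by blast
  qed
qed

section \<open>The associated bilinear form\<close>

text \<open>Each coefficient with \<open>i < j\<close> is split evenly between the two mixed
  products, which makes the form symmetric with diagonal values \<open>qform_eval\<close>.\<close>

definition qform_bilinear :: "nat \<Rightarrow> (nat \<Rightarrow> nat \<Rightarrow> real) \<Rightarrow> (nat \<Rightarrow> real) \<Rightarrow> (nat \<Rightarrow> real) \<Rightarrow> real" where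
  "qform_bilinear n a x y = (\<Sum>i = 1..n. \<Sum>j = i..n. a i j * (x i * y j + x j * y i) / 2)"

lemma qform_bilinear_self: "qform_bilinear n a x x = qform_eval n a x"
  unfolding qform_bilinear_def qform_eval_def by (intro sum.cong refl) simp

lemma qform_eval_comb:
  "qform_eval n a (\<lambda>k. s * x k + t * y k) =
     s * s * qform_eval n a x + 2 * s * t * qform_bilinear n a x y + t * t * qform_eval n a y"
  unfolding qform_bilinear_def qform_eval_def sum_distrib_left sum.distrib[symmetric]
  by (intro sum.cong refl) (simp add: algebra_simps)

lemma qform_bilinear_sum_left:
  "qform_bilinear n a (\<lambda>i. \<Sum>k\<in>S. c k * v k i) y = (\<Sum>k\<in>S. c k * qform_bilinear n a (v k) y)"
proof (induction S rule: infinite_finite_induct)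
  case (insert l S)
  have "qform_bilinear n a (\<lambda>i. c l * v l i + z i) y = c l * qform_bilinear n a (v l) y + qform_bilinear n a z y" for z
    unfolding qform_bilinear_def sum_distrib_left sum.distrib[symmetric]
    by (intro sum.cong refl) (simp add: algebra_simps add_divide_distrib)
  then show ?case using insert by simp
qed (simp_all add: qform_bilinear_def)

lemma qform_bilinear_zero:
  "(\<And>i. i \<in> {1..n} \<Longrightarrow> x i = 0) \<Longrightarrow> qform_bilinear n a x y = 0"
  unfolding qform_bilinear_def by (intro sum.neutral ballI) auto

text \<open>Pairing a linear dependence with \<open>v l\<close> leaves only \<open>c l\<close> times
  the nonzero value of the form at \<open>v l\<close>.\<close>

lemma orthogonal_imp_card_le:
  assumes "finite S" "\<And>k. k \<in> S \<Longrightarrow> qform_eval n a (v k) \<noteq> 0"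
    and "\<And>k l. k \<in> S \<Longrightarrow> l \<in> S \<Longrightarrow> k \<noteq> l \<Longrightarrow> qform_bilinear n a (v k) (v l) = 0"
  shows "card S \<le> n"
proof (rule ccontr)
  assume "\<not> card S \<le> n"
  then have "card {1..n} < card S" by simp
  then obtain c where c: "\<exists>k\<in>S. c k \<noteq> 0" "\<forall>i\<in>{1..n}. (\<Sum>k\<in>S. c k * v k i) = 0"
    using linear_dependence[of "{1..n}" S v] assms(1) by auto
  have "c l = 0" if "l \<in> S" for l
  proof -
    have "0 = qform_bilinear n a (\<lambda>i. \<Sum>k\<in>S. c k * v k i) (v l)"
      using c(2) by (intro qform_bilinear_zero[symmetric]) blast
    also have "\<dots> = (\<Sum>k\<in>S. c k * qform_bilinear n a (v k) (v l))"
      by (rule qform_bilinear_sum_left)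
    also have "\<dots> = c l * qform_bilinear n a (v l) (v l)"
      using assms(1,3) that by (subst sum.remove[of _ l]) (auto intro!: sum.neutral)
    finally show ?thesis using assms(2)[OF that] by (simp add: qform_bilinear_self)
  qed
  then show False using c(1) by blast
qed

lemma sum_in_ring_of_integers_K0:
  "(\<And>i. i \<in> A \<Longrightarrow> f i \<in> ring_of_integers K0) \<Longrightarrow> sum f A \<in> ring_of_integers K0"
proof (induction A rule: infinite_finite_induct)
  have "qval (sqrt 6) (sqrt 19) (0, 0, 0, 0) = 0" by (simp add: qval_eq_0)
  then have "0 \<in> ring_of_integers K0" unfolding ring_of_integers_K0 by (metis rangeI)
  then show "sum f A \<in> ring_of_integers K0" if "infinite A" for A using that by simp
  show "sum f {} \<in> ring_of_integers K0" using \<open>0 \<in> _\<close> by simp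
qed (simp add: ring_of_integers_K0_closed)

text \<open>The denominator 2 is absorbed by the coefficient off the diagonal, as the form is
  classical, and by the doubled product \<open>x i * y i\<close> on it.\<close>

lemma qform_bilinear_in_ring_of_integers:
  assumes "quadratic_form_over K0 n a" "classical_form K0 n a"
    and "\<And>i. i \<in> {1..n} \<Longrightarrow> x i \<in> ring_of_integers K0" "\<And>i. i \<in> {1..n} \<Longrightarrow> y i \<in> ring_of_integers K0"
  shows "qform_bilinear n a x y \<in> ring_of_integers K0"
  unfolding qform_bilinear_def
proof (intro sum_in_ring_of_integers_K0)
  fix i j assume ij: "i \<in> {1..n}" "j \<in> {i..n}"
  note R = ring_of_integers_K0_closed
  have "x i * y j + x j * y i \<in> ring_of_integers K0"
    using assms(3,4) ij by (intro R) auto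
  moreover have "x i * y i \<in> ring_of_integers K0"
    using assms(3,4) ij by (intro R) auto
  moreover have "a i j \<in> ring_of_integers K0" using assms(1) ij by (auto simp: quadratic_form_over_def)
  moreover have "\<exists>b\<in>ring_of_integers K0. a i j = 2 * b" if "i \<noteq> j"
    using assms(2) ij that by (auto simp: classical_form_def)
  ultimately show "a i j * (x i * y j + x j * y i) / 2 \<in> ring_of_integers K0"
    by (cases "i = j") (auto intro: R)
qed

lemma conj_at_qform_nonneg:
  assumes "quadratic_form_over K0 n a" "classical_form K0 n a" "totally_positive_definite K0 n a"
    and "\<And>i. i \<in> {1..n} \<Longrightarrow> x i \<in> ring_of_integers K0" "(r, s) \<in> sqrts"
  shows "0 \<le> conj_at r s (qform_eval n a x)"
proof (cases "\<exists>i\<in>{1..n}. x i \<noteq> 0")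
  case True
  then have "totally_positive K0 (qform_eval n a x)"
    using assms(3,4) by (auto simp: totally_positive_definite_def)
  moreover have "qform_eval n a x \<in> K0"
    using qform_bilinear_in_ring_of_integers[OF assms(1,2), of x x] assms(4)
    by (simp add: qform_bilinear_self ring_of_integers_def)
  ultimately show ?thesis
    using assms(5) by (auto simp: totally_positive_iff intro: less_imp_le)
next
  case False
  then have "qform_eval n a x = 0"
    unfolding qform_bilinear_self[symmetric] by (intro qform_bilinear_zero) auto
  then show ?thesis by (simp add: conj_at_Rats)
qed

text \<open>Evaluating the form at \<open>\<alpha> y - B(x, y) x\<close>, where \<open>\<alpha> = Q(x)\<close>, gives the
  Cauchy--Schwarz inequality in every real embedding.\<close>

lemma conj_Cauchy_Schwarz:
  assumes "quadratic_form_over K0 n a" "classical_form K0 n a" "totally_positive_definite K0 n a"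
    and x: "\<And>i. i \<in> {1..n} \<Longrightarrow> x i \<in> ring_of_integers K0" "qform_eval n a x = qval (sqrt 6) (sqrt 19) u"
    and y: "\<And>i. i \<in> {1..n} \<Longrightarrow> y i \<in> ring_of_integers K0" "qform_eval n a y = qval (sqrt 6) (sqrt 19) v"
    and g: "qform_bilinear n a x y = qval (sqrt 6) (sqrt 19) g"
    and "qpos u" and rs: "(r, s) \<in> sqrts"
  shows "(qval r s g)\<^sup>2 \<le> qval r s u * qval r s v"
proof -
  let ?q = "qval (sqrt 6) (sqrt 19)"
  note R = ring_of_integers_K0_closed
  have mem: "?q w \<in> ring_of_integers K0" for w unfolding ring_of_integers_K0 by simp
  define z where "z k = - ?q g * x k + ?q u * y k" for k
  have "qform_eval n a z = ?q u * (?q u * ?q v - ?q g * ?q g)"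
    unfolding z_def qform_eval_comb x(2) y(2) g by (simp add: algebra_simps)
  also have "\<dots> = ?q (qmul u (qsub (qmul u v) (qmul g g)))"
    by (simp add: qval_qsub qval_qmul[OF std_sqrts])
  finally have "conj_at r s (qform_eval n a z) = qval r s u * (qval r s u * qval r s v - (qval r s g)\<^sup>2)"
    by (simp add: conj_at_qval qval_qsub qval_qmul[OF rs] power2_eq_square)
  moreover have "0 \<le> conj_at r s (qform_eval n a z)"
  proof (rule conj_at_qform_nonneg[OF assms(1-3) _ rs])
    fix i assume "i \<in> {1..n}"
    then show "z i \<in> ring_of_integers K0"
      unfolding z_def using x(1) y(1) mem by (intro R) auto
  qed
  \<comment> \<open>The factor \<open>qval r s u\<close> is positive and can be cancelled.\<close>
  ultimately show ?thesis
    using qposD[OF \<open>qpos u\<close> rs] by (simp add: zero_le_mult_iff)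
qed

section \<open>Six pairwise orthogonal elements\<close>

lemma qform_bilinear_commute: "qform_bilinear n a x y = qform_bilinear n a y x"
  unfolding qform_bilinear_def by (intro sum.cong refl) (simp add: add.commute mult.commute)

text \<open>The third entry of a triple \<open>(u, v, m)\<close> is a unit whose square balances the conjugates of the
  product of the first two, so that few squares have to be compared with it.\<close>

definition orthogonal_triples :: "(quad \<times> quad \<times> quad) set" where
  "orthogonal_triples = set
   [((1, 0, 0, 0), (5, 2, 0, 0), (5, -2, 0, 0)),
    ((1, 0, 0, 0), (53, 7, 12, 4), (13, -8, -3, 3)),
    ((1, 0, 0, 0), (32, 9, 7, 5), (1, 0, 0, 0)),
    ((1, 0, 0, 0), (97, -46, -22, 17), (13, 5, 3, 3)),
    ((1, 0, 0, 0), (131, 51, -30, -19), (13, -5, 3, -3)),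
    ((5, 2, 0, 0), (53, 7, 12, 4), (143, -72, -33, 27)),
    ((5, 2, 0, 0), (32, 9, 7, 5), (5, -2, 0, 0)),
    ((5, 2, 0, 0), (97, -46, -22, 17), (13, 5, 3, 3)),
    ((5, 2, 0, 0), (131, 51, -30, -19), (13, -5, 3, -3)),
    ((53, 7, 12, 4), (32, 9, 7, 5), (13, -8, -3, 3)),
    ((53, 7, 12, 4), (97, -46, -22, 17), (1, 0, 0, 0)),
    ((53, 7, 12, 4), (131, 51, -30, -19), (5, -2, 0, 0)),
    ((32, 9, 7, 5), (97, -46, -22, 17), (1, 0, 0, 0)),
    ((32, 9, 7, 5), (131, 51, -30, -19), (5, -2, 0, 0)),
    ((97, -46, -22, 17), (131, 51, -30, -19), (13, 5, 3, 3))]"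

text \<open>The absolute norms are 1, 1, 25, 30, 30 and 142. The second element is the unit
  \<open>5 + 2 * sqrt 6\<close>, the square of \<open>sqrt 2 + sqrt 3\<close>, which lies outside
  the field.\<close>

definition six_elements :: "quad set" where
  "six_elements = {(1, 0, 0, 0), (5, 2, 0, 0), (53, 7, 12, 4), (32, 9, 7, 5), (97, -46, -22, 17), (131, 51, -30, -19)}"

text \<open>The computational core: 15 products, each compared with the squares of the 819 elements
  of the box.\<close>

lemma orthogonal_triples_check:
  "\<forall>(u, v, m) \<in> orthogonal_triples. fst (qmul (qmul m m) (qmul u v)) \<le> 40 \<and> m \<noteq> (0, 0, 0, 0) \<and>
     dominates_no_square (qmul (qmul m m) (qmul u v))"
  by code_simp

lemma six_elements_pos: "u \<in> six_elements \<Longrightarrow> qpos u"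
  by (auto simp: six_elements_def)

lemma card_six_elements: "finite six_elements" "card six_elements = 6"
  by (simp_all add: six_elements_def)

text \<open>Each of the 15 unordered pairs is listed in one order only; symmetry of the bilinear
  form supplies the other.\<close>

lemma six_elements_triples:
  assumes "u \<in> six_elements" "v \<in> six_elements" "u \<noteq> v"
  shows "(\<exists>m. (u, v, m) \<in> orthogonal_triples) \<or> (\<exists>m. (v, u, m) \<in> orthogonal_triples)"
  using assms unfolding six_elements_def orthogonal_triples_def by fastforce

theorem proposition5p4:
  fixes K :: "real set" and n :: nat and a :: "nat \<Rightarrow> nat \<Rightarrow> real"
  assumes "K = adjoin_rats {sqrt 6, sqrt 19}"
    and "quadratic_form_over K n a"
    and "totally_positive_definite K n a"
    and "classical_form K n a"
    and "universal_form K n a"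
  shows "n \<ge> 6"
proof -
  let ?q = "qval (sqrt 6) (sqrt 19)"
  note form = assms(2,4,3)[unfolded assms(1)]
  have "\<exists>x. (\<forall>i\<in>{1..n}. x i \<in> ring_of_integers K0) \<and> qform_eval n a x = ?q u" if "u \<in> six_elements" for u
  proof -
    have "totally_positive K0 (?q u)"
      using qposD[OF six_elements_pos[OF that]] by (simp add: totally_positive_iff qval_in_K0 conj_at_qval)
    moreover have "?q u \<in> ring_of_integers K0"
      by (simp add: ring_of_integers_K0)
    ultimately show ?thesis
      using assms(5) unfolding assms(1) universal_form_def by blast
  qed
  \<comment> \<open>The representing vectors are indexed by the six elements themselves.\<close>
  then obtain v where v: "\<And>u i. u \<in> six_elements \<Longrightarrow> i \<in> {1..n} \<Longrightarrow> v u i \<in> ring_of_integers K0"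
    "\<And>u. u \<in> six_elements \<Longrightarrow> qform_eval n a (v u) = ?q u"
    by metis
  have orth: "qform_bilinear n a (v u) (v w) = 0"
    if uw: "u \<in> six_elements" "w \<in> six_elements" and m: "(u, w, m) \<in> orthogonal_triples" for u w m
  proof -
    have "qform_bilinear n a (v u) (v w) \<in> ring_of_integers K0"
      by (rule qform_bilinear_in_ring_of_integers[OF form(1,2)]) (use v uw in auto)
    then obtain g where g: "qform_bilinear n a (v u) (v w) = ?q g"
      unfolding ring_of_integers_K0 by blast
    have "(qval x y g)\<^sup>2 \<le> qval x y u * qval x y w" if "(x, y) \<in> sqrts" for x y
      by (rule conj_Cauchy_Schwarz[OF form v(1)[OF uw(1)] v(2)[OF uw(1)] v(1)[OF uw(2)] v(2)[OF uw(2)] g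
            six_elements_pos[OF uw(1)] that])
    then have "g = (0, 0, 0, 0)"
      using orthogonal_triples_check m by (intro no_common_square[of m u w g]) auto
    then show ?thesis using g by (simp add: qval_eq_0)
  qed
  have "card six_elements \<le> n"
  proof (rule orthogonal_imp_card_le[of _ _ a v])
    fix u assume "u \<in> six_elements"
    moreover from this have "u \<noteq> (0, 0, 0, 0)" using six_elements_pos by fastforce
    ultimately show "qform_eval n a (v u) \<noteq> 0" using v(2) by (simp add: qval_eq_0)
  next
    fix u w assume "u \<in> six_elements" "w \<in> six_elements" "u \<noteq> w"
    then show "qform_bilinear n a (v u) (v w) = 0"
      using six_elements_triples[of u w] orth qform_bilinear_commute by metis
  qed (rule card_six_elements)
  then show ?thesis by (simp add: card_six_elements)
qed

end
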